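(* There exists an online algorithm for the Matroid Prophet Secretary problem (defined in the context) whose expected total value of selected elements is at least $(1-1/e)\cdot \mathbb{E}\big[\max_{I\in\mathcal{I}}\sum_{i\in I} v_i\big]$.
   Context: Matroid Prophet Secretary problem: a matroid $\mathcal{M}=([n],\mathcal{I})$ is given. Element (buyer) $i\in[n]$ has a nonnegative random value $v_i$ drawn from a known distribution, the $v_i$ being mutually independent. The elements arrive in a uniformly random order (equivalently, each element $i$ arrives at an independent time $T_i$ uniform on $[0,1]$, independent of the values, and elements are processed in increasing order of arrival time). When element $i$ arrives its value $v_i$ is revealed and the algorithm must immediately and irrevocably decide whether to select $i$; the set of selected elements must be independent in $\mathcal{M}$ at all times. The expectation of the algorithm's value is over the values, the arrival order and the algorithm's internal randomness. *)

theory Defs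
  imports "HOL-Probability.Probability" "HOL-Combinatorics.Multiset_Permutations"
begin

definition matroid_on :: "nat \<Rightarrow> (nat set \<Rightarrow> bool) \<Rightarrow> bool" where
  "matroid_on n indep \<longleftrightarrow>
     (\<forall>I. indep I \<longrightarrow> I \<subseteq> {..<n}) \<and>
     indep {} \<and>
     (\<forall>I J. indep J \<and> I \<subseteq> J \<longrightarrow> indep I) \<and>
     (\<forall>I J. indep I \<and> indep J \<and> card I < card J \<longrightarrow> (\<exists>x\<in>J - I. indep (insert x I)))"

text \<open>History seen by an online algorithm: list of (element, its revealed value,
  decision taken), in arrival order.\<close>
type_synonym history = "(nat \<times> real \<times> bool) list"

text \<open>A (deterministic, for a fixed random seed) online decision rule: given the history,
  the arriving element and its value, decide whether to select it.\<close>
type_synonym online_rule = "history \<Rightarrow> nat \<Rightarrow> real \<Rightarrow> bool"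

fun run_alg :: "online_rule \<Rightarrow> (nat \<Rightarrow> real) \<Rightarrow> nat list \<Rightarrow> history \<Rightarrow> history" where
  "run_alg A v [] h = h"
| "run_alg A v (i # \<sigma>) h = run_alg A v \<sigma> (h @ [(i, v i, A h i (v i))])"

definition selected :: "online_rule \<Rightarrow> (nat \<Rightarrow> real) \<Rightarrow> nat list \<Rightarrow> nat set" where
  "selected A v \<sigma> = {i. \<exists>x. (i, x, True) \<in> set (run_alg A v \<sigma> [])}"

definition alg_value :: "online_rule \<Rightarrow> (nat \<Rightarrow> real) \<Rightarrow> nat list \<Rightarrow> real" where
  "alg_value A v \<sigma> = (\<Sum>i\<in>selected A v \<sigma>. v i)"

definition opt_value :: "(nat set \<Rightarrow> bool) \<Rightarrow> (nat \<Rightarrow> real) \<Rightarrow> real" where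
  "opt_value indep v = Max {(\<Sum>i\<in>I. v i) | I. indep I}"

end

theory Submission
  imports Defs
begin

text \<open>
  Let every element arrive at an independent uniform time and put \<open>\<alpha>(t) = 1 - exp (t - 1)\<close>. For a selected
  set \<open>A\<close> let \<open>R(A)\<close> be the expected weight of an optimal completion of \<open>A\<close> under fresh values, and ask
  an element \<open>i\<close> arriving at time \<open>t\<close> to pay \<open>\<alpha>(t) (R(A) - R(A + i))\<close>; it is selected if this keeps
  independence and its value covers the price. Since \<open>\<alpha>(s)\<close> is the integral of \<open>1 - \<alpha>\<close> over \<open>[s, 1]\<close>,
  the total revenue telescopes to \<open>\<alpha>(0) R({}) - \<integral> (1 - \<alpha>(t)) R(A\<^sub>t) dt\<close>, where \<open>A\<^sub>t\<close> is the set selected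
  before time \<open>t\<close>. The expected total utility is at least \<open>\<integral> (1 - \<alpha>(t)) E R(A\<^sub>t) dt\<close>, so that the welfare is
  at least \<open>\<alpha>(0) R({}) = (1 - 1/e) R({})\<close>: an unselected element leaves no trace in the process, hence an
  element arriving at \<open>t\<close> can be charged against the unconditional set \<open>A\<^sub>t\<close>, and submodularity of \<open>R\<close>
  shows that the drops \<open>R(A) - R(A + i)\<close> summed over a completion of \<open>A\<close> are at most \<open>R(A)\<close>.

  Some fixed choice of the \<open>n\<close> ordered arrival times does at least as well as the average, which makes the
  rule deterministic. If the expected optimum is infinite, some single element has infinite mean.
\<close>

section \<open>Matroid exchange and residual optima\<close>

locale finite_matroid =
  fixes n :: nat and indep :: "nat set \<Rightarrow> bool"
  assumes matroid: "matroid_on n indep"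
begin

lemma indep_ground: "indep I \<Longrightarrow> I \<subseteq> {..<n}"
  using matroid unfolding matroid_on_def by blast

lemma indep_empty: "indep {}"
  using matroid unfolding matroid_on_def by blast

lemma indep_subset: "indep J \<Longrightarrow> I \<subseteq> J \<Longrightarrow> indep I"
  using matroid unfolding matroid_on_def by blast

lemma indep_augment: "indep I \<Longrightarrow> indep J \<Longrightarrow> card I < card J \<Longrightarrow> \<exists>x\<in>J - I. indep (insert x I)"
  using matroid unfolding matroid_on_def by blast

lemma indep_finite: "indep I \<Longrightarrow> finite I"
  using indep_ground finite_subset by blast

lemma indep_extend:
  assumes "indep I" "indep J" "card I \<le> card J"
  shows "\<exists>N. indep N \<and> I \<subseteq> N \<and> N \<subseteq> I \<union> J \<and> card N = card J"
  using assms
proof (induction "card J - card I" arbitrary: I)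
  case 0
  then show ?case by (intro exI[of _ I]) auto
next
  case (Suc k)
  then have "card I < card J" by simp
  then obtain x where x: "x \<in> J - I" "indep (insert x I)"
    using indep_augment Suc.prems by blast
  have c: "card (insert x I) = Suc (card I)"
    using x indep_finite Suc.prems by simp
  obtain N where "indep N" "insert x I \<subseteq> N" "N \<subseteq> insert x I \<union> J" "card N = card J"
    using Suc.hyps(1)[of "insert x I"] Suc.hyps(2) c x Suc.prems \<open>card I < card J\<close>
    by (metis Suc_leI diff_Suc_1 diff_Suc_eq_diff_pred diff_commute)
  then show ?case using x by blast
qed

text \<open>Let \<open>K\<close> be the part of \<open>X\<close> on the circuit of \<open>i\<close>,
  and \<open>Z = Y - {i}\<close>. If no exchange exists, no element of \<open>K - Y\<close> can be
  added to \<open>Z\<close>, so \<open>Z\<close> is largest among the independent subsets of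
  \<open>K \<union> Z\<close>. Extend \<open>K\<close> inside \<open>K \<union> Z\<close> to the
  size of \<open>Z\<close>: augmenting the result from \<open>Y\<close> can only add
  \<open>i\<close>, which would make the circuit independent.\<close>

lemma symmetric_exchange:
  assumes X: "indep X" and Y: "indep Y" and i: "i \<in> Y" "i \<notin> X" and dep: "\<not> indep (insert i X)"
  shows "\<exists>x\<in>X - Y. indep (insert i (X - {x})) \<and> indep (insert x (Y - {i}))"
proof (rule ccontr)
  assume neg: "\<not> ?thesis"
  define K where "K = {x\<in>X. indep (insert i (X - {x}))}"
  define Z where "Z = Y - {i}"
  have fin: "finite X" "finite Y" using X Y indep_finite by auto
  have Z: "indep Z" unfolding Z_def by (rule indep_subset[OF Y]) auto
  have cY: "card Y = Suc (card Z)" using fin i unfolding Z_def by (metis card_Suc_Diff1)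
  have K: "indep K" unfolding K_def by (rule indep_subset[OF X]) auto
  \<comment> \<open>\<open>insert i K\<close> is the fundamental circuit of \<open>i\<close> with respect to \<open>X\<close>.\<close>
  have iK: "\<not> indep (insert i K)"
  proof
    assume iK: "indep (insert i K)"
    have "K \<noteq> X" using iK dep by auto
    then have "card K < card X" using fin unfolding K_def by (intro psubset_card_mono) auto
    then have "card (insert i K) \<le> card X"
      using fin i K indep_finite by (simp add: card_insert_if)
    from indep_extend[OF iK X this]
    obtain N where N: "indep N" "insert i K \<subseteq> N" "N \<subseteq> insert i K \<union> X" "card N = card X"
      by blast
    \<comment> \<open>\<open>N\<close> has the size of \<open>X\<close> and contains
      \<open>i\<close>, so it is \<open>X\<close> with some \<open>x\<close> traded for
      \<open>i\<close>. That trade puts \<open>x\<close> into \<open>K\<close>, which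
      \<open>N\<close> contains.\<close>
    have "N \<noteq> insert i X" using N dep by auto
    then obtain x where x: "x \<in> X" "x \<notin> N" using N unfolding K_def by auto
    have "N \<subseteq> insert i (X - {x})" using N x unfolding K_def by auto
    moreover have "card (insert i (X - {x})) = card N"
      using N(4) fin x(1) i(2) card_Suc_Diff1[of X x] by simp
    ultimately have "N = insert i (X - {x})"
      using fin by (intro card_subset_eq) auto
    then have "x \<in> K" using N x unfolding K_def by auto
    then show False using N x by auto
  qed
  have bound: "card J \<le> card Z" if J: "indep J" "J \<subseteq> K \<union> Z" for J
  proof (rule ccontr)
    assume "\<not> card J \<le> card Z"
    then obtain x where x: "x \<in> J - Z" "indep (insert x Z)" using indep_augment Z J by force
    then have "x \<in> K" using J by auto
    then have "x \<notin> Y" "x \<in> X" using x i unfolding K_def Z_def by auto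
    then show False using neg x \<open>x \<in> K\<close> unfolding K_def Z_def by auto
  qed
  obtain M where M: "indep M" "K \<subseteq> M" "M \<subseteq> K \<union> Z" "card M = card Z"
    using indep_extend[OF K Z] bound[OF K] by auto
  then obtain y where y: "y \<in> Y - M" "indep (insert y M)"
    using indep_augment[of M Y] Y cY by auto
  have "y = i"
  proof (rule ccontr)
    assume "y \<noteq> i"
    then have "insert y M \<subseteq> K \<union> Z" using y M unfolding Z_def by auto
    then have "card (insert y M) \<le> card Z" using bound y by blast
    then show False using y M indep_finite by simp
  qed
  then have "indep (insert i K)" using y M indep_subset[of "insert y M" "insert i K"] by auto
  then show False using iK by simp
qed

section \<open>Contractions and their optimal weights\<close>

definition completions :: "nat set \<Rightarrow> nat set set" where
  "completions A = {S. S \<inter> A = {} \<and> indep (S \<union> A)}"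

text \<open>For independent \<open>A\<close> this is the maximum weight of an independent set in the
  contraction of the matroid by \<open>A\<close>. For dependent \<open>A\<close> there are no
  completions and the maximum of the empty set is unspecified, hence the independence hypotheses
  below.\<close>

definition residual :: "nat set \<Rightarrow> (nat \<Rightarrow> real) \<Rightarrow> real" where
  "residual A v = Max ((\<lambda>S. \<Sum>i\<in>S. v i) ` completions A)"

lemma completions_ground: "S \<in> completions A \<Longrightarrow> S \<subseteq> {..<n}"
  using indep_ground unfolding completions_def by auto

lemma finite_completions: "finite (completions A)"
  by (rule finite_subset[of _ "Pow {..<n}"]) (auto dest: completions_ground)

lemma empty_in_completions: "indep A \<Longrightarrow> {} \<in> completions A"
  unfolding completions_def by simp

lemma residual_ge: "S \<in> completions A \<Longrightarrow> (\<Sum>i\<in>S. v i) \<le> residual A v"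
  unfolding residual_def using finite_completions by auto

lemma residual_attained:
  assumes "indep A"
  obtains S where "S \<in> completions A" "residual A v = (\<Sum>i\<in>S. v i)"
proof -
  have "residual A v \<in> (\<lambda>S. \<Sum>i\<in>S. v i) ` completions A"
    unfolding residual_def using finite_completions empty_in_completions[OF assms]
    by (intro Max_in) auto
  then show ?thesis using that by auto
qed

lemma residual_nonneg: "indep A \<Longrightarrow> 0 \<le> residual A v"
  using residual_ge[OF empty_in_completions, of A v] by simp

text \<open>Let \<open>X\<close> and \<open>Y\<close> be \<open>A\<close> and
  \<open>insert i (insert j A)\<close> with optimal completions. Unless \<open>X\<close> has
  \<open>i\<close> already, move \<open>i\<close> from \<open>Y\<close> to \<open>X\<close>, sending
  some \<open>x\<close> back if \<open>X\<close> cannot take it. The resulting sets complete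
  \<open>insert i A\<close> and \<open>insert j A\<close> without loss of total weight.\<close>

lemma residual_insert_submodular:
  assumes ij: "i \<noteq> j" "i \<notin> A" "j \<notin> A" and ind: "indep (insert i (insert j A))"
  shows "residual A v + residual (insert i (insert j A)) v
    \<le> residual (insert i A) v + residual (insert j A) v"
proof -
  have indA: "indep A" by (rule indep_subset[OF ind]) auto
  obtain B1 where B1: "B1 \<in> completions A" "residual A v = (\<Sum>k\<in>B1. v k)"
    using residual_attained[OF indA] by blast
  obtain B2 where B2: "B2 \<in> completions (insert i (insert j A))"
      "residual (insert i (insert j A)) v = (\<Sum>k\<in>B2. v k)"
    using residual_attained[OF ind] by blast
  define X where "X = B1 \<union> A"
  define Y where "Y = B2 \<union> insert i (insert j A)"
  have X: "indep X" and Y: "indep Y" and iY: "i \<in> Y" and AY: "A \<subseteq> Y" and jY: "j \<in> Y"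
    and AX: "A \<subseteq> X" and dis: "B1 \<inter> A = {}" "B2 \<inter> A = {}" "i \<notin> B2" "j \<notin> B2"
    using B1 B2 unfolding X_def Y_def completions_def by auto
  have fin: "finite X" "finite Y" using X Y indep_finite by auto
  have finB: "finite B1" "finite B2" using fin unfolding X_def Y_def by auto
  have key: "(\<Sum>k\<in>X' - insert i A. v k) + (\<Sum>k\<in>Y' - insert j A. v k)
      \<le> residual (insert i A) v + residual (insert j A) v"
    if "indep X'" "indep Y'" "insert i A \<subseteq> X'" "insert j A \<subseteq> Y'" for X' Y'
  proof -
    have "X' - insert i A \<in> completions (insert i A)" "Y' - insert j A \<in> completions (insert j A)"
      using that indep_subset unfolding completions_def by (auto simp: Un_absorb2 insert_absorb)
    then show ?thesis by (intro add_mono residual_ge)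
  qed
  consider (mem) "i \<in> X" | (free) "i \<notin> X" "indep (insert i X)" | (dep) "i \<notin> X" "\<not> indep (insert i X)"
    by blast
  then show ?thesis
  proof cases
    case mem
    then have "i \<in> B1" using ij unfolding X_def by auto
    have e: "X - insert i A = B1 - {i}" "Y - insert j A = insert i B2"
      using ij dis unfolding X_def Y_def by auto
    have "(\<Sum>k\<in>B1. v k) = v i + (\<Sum>k\<in>B1 - {i}. v k)"
      using \<open>i \<in> B1\<close> finB by (simp add: sum.remove)
    then show ?thesis using key[of X Y] e X Y mem AX AY jY B1 B2 dis finB by simp
  next
    case free
    have e: "insert i X - insert i A = B1" "(Y - {i}) - insert j A = B2"
      using ij dis free unfolding X_def Y_def by auto
    have "indep (Y - {i})" by (rule indep_subset[OF Y]) auto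
    moreover have "insert i A \<subseteq> insert i X" "insert j A \<subseteq> Y - {i}" using AX AY jY ij by auto
    ultimately show ?thesis using key[of "insert i X" "Y - {i}"] e free B1(2) B2(2) by simp
  next
    case dep
    obtain x where x: "x \<in> X - Y" "indep (insert i (X - {x}))" "indep (insert x (Y - {i}))"
      using symmetric_exchange[OF X Y iY dep] by blast
    have xB: "x \<in> B1" "x \<notin> B2" "x \<notin> A" "x \<noteq> i" "x \<noteq> j"
      using x AY iY jY unfolding X_def Y_def by auto
    have e: "insert i (X - {x}) - insert i A = B1 - {x}" "insert x (Y - {i}) - insert j A = insert x B2"
      using ij dis xB dep unfolding X_def Y_def by auto
    have "(\<Sum>k\<in>B1. v k) = v x + (\<Sum>k\<in>B1 - {x}. v k)"
      using xB finB by (simp add: sum.remove)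
    moreover have "insert i A \<subseteq> insert i (X - {x})" "insert j A \<subseteq> insert x (Y - {i})"
      using AX AY jY ij xB by auto
    ultimately show ?thesis
      using key[OF x(2,3)] e B1(2) B2(2) xB(2) finB by simp
  qed
qed

lemma residual_drop_mono:
  assumes "finite S" "j \<notin> S \<union> A" "S \<inter> A = {}" "indep (insert j (S \<union> A))"
  shows "residual A v - residual (insert j A) v
    \<le> residual (S \<union> A) v - residual (insert j (S \<union> A)) v"
  using assms
proof (induction S rule: finite_induct)
  case (insert i S)
  have "indep (insert j (S \<union> A))" by (rule indep_subset[OF insert.prems(3)]) auto
  then have "residual A v - residual (insert j A) v
    \<le> residual (S \<union> A) v - residual (insert j (S \<union> A)) v"
    using insert by auto
  also have "\<dots> \<le> residual (insert i (S \<union> A)) v - residual (insert j (insert i (S \<union> A))) v"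
    using residual_insert_submodular[of j i "S \<union> A" v] insert by auto
  finally show ?case by simp
qed simp

text \<open>Insert the elements of \<open>S\<close> one at a time. By submodularity each drop
  measured at \<open>A\<close> is at most the drop at the moment of insertion, and the latter
  telescope.\<close>

lemma sum_residual_drop:
  assumes "finite S" "S \<inter> A = {}" "indep (S \<union> A)"
  shows "(\<Sum>i\<in>S. residual A v - residual (insert i A) v) \<le> residual A v - residual (S \<union> A) v"
  using assms
proof (induction S rule: finite_induct)
  case (insert j S)
  have "indep (S \<union> A)" by (rule indep_subset[OF insert.prems(2)]) auto
  then have "(\<Sum>i\<in>S. residual A v - residual (insert i A) v) \<le> residual A v - residual (S \<union> A) v"
    using insert by auto
  moreover have "residual A v - residual (insert j A) v
    \<le> residual (S \<union> A) v - residual (insert j (S \<union> A)) v"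
    using insert by (intro residual_drop_mono) auto
  ultimately show ?case using insert by simp
qed simp

lemma sum_residual_drop_completion:
  assumes "S \<in> completions A"
  shows "(\<Sum>i\<in>S. residual A v - residual (insert i A) v) \<le> residual A v"
proof -
  have S: "S \<inter> A = {}" "indep (S \<union> A)" using assms unfolding completions_def by auto
  have "finite S" using S indep_finite by blast
  then show ?thesis
    using sum_residual_drop[OF _ S, of v] residual_nonneg[OF S(2), of v] by simp
qed

lemma residual_mono:
  assumes "A \<subseteq> B" "indep B"
  shows "residual B v \<le> residual A v"
proof -
  obtain S where S: "S \<in> completions B" "residual B v = (\<Sum>i\<in>S. v i)"
    using residual_attained assms by blast
  have "indep (S \<union> A)" using S assms indep_subset[of "S \<union> B" "S \<union> A"] unfolding completions_def by auto
  then have "S \<in> completions A" using S assms unfolding completions_def by auto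
  then show ?thesis using S residual_ge by metis
qed

lemma opt_value_eq_residual: "opt_value indep v = residual {} v"
proof -
  have "{(\<Sum>i\<in>I. v i) | I. indep I} = (\<lambda>S. \<Sum>i\<in>S. v i) ` completions {}"
    unfolding completions_def by auto
  then show ?thesis unfolding opt_value_def residual_def by simp
qed

end

section \<open>The threshold process\<close>

text \<open>With strictly increasing keys, the entries before \<open>i\<close> are exactly those
  with a smaller key. Each intermediate state is thus described by a time instead of a list
  position, so that arrival times can be integrated later.\<close>

lemma fold_telescope:
  fixes T :: "nat \<Rightarrow> real" and H :: "'a \<Rightarrow> real"
  assumes "sorted_wrt (\<lambda>i j. T i < T j) xs"
  shows "H (fold f xs a) - H a =
    (\<Sum>i\<in>set xs. H (f i (fold f (filter (\<lambda>j. T j < T i) xs) a)) - H (fold f (filter (\<lambda>j. T j < T i) xs) a))"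
  using assms
proof (induction xs rule: rev_induct)
  case (snoc x xs)
  let ?\<Delta> = "\<lambda>ys i. H (f i (fold f (filter (\<lambda>j. T j < T i) ys) a)) - H (fold f (filter (\<lambda>j. T j < T i) ys) a)"
  have lt: "T i < T x" if "i \<in> set xs" for i
    using snoc.prems that by (auto simp: sorted_wrt_append)
  have x: "x \<notin> set xs" using lt by auto
  have fx: "filter (\<lambda>j. T j < T x) (xs @ [x]) = xs"
    using lt by (auto simp: filter_id_conv)
  \<comment> \<open>The last entry has the largest key, so it enters none of the earlier
    states.\<close>
  have "(\<Sum>i\<in>set xs. ?\<Delta> (xs @ [x]) i) = (\<Sum>i\<in>set xs. ?\<Delta> xs i)"
    by (intro sum.cong refl) (use lt in \<open>fastforce simp: not_less less_imp_le\<close>)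
  then have "(\<Sum>i\<in>set (xs @ [x]). ?\<Delta> (xs @ [x]) i) = ?\<Delta> (xs @ [x]) x + (\<Sum>i\<in>set xs. ?\<Delta> xs i)"
    using x by simp
  also have "\<dots> = H (f x (fold f xs a)) - H (fold f xs a) + (H (fold f xs a) - H a)"
    using snoc by (simp add: fx sorted_wrt_append)
  finally show ?case by simp
qed simp

lemma sort_key_cong_on:
  assumes "\<And>x. x \<in> set xs \<Longrightarrow> f x = g x"
  shows "sort_key f xs = sort_key g xs"
  using assms
proof (induction xs)
  case (Cons x xs)
  have ins: "insort_key f x ys = insort_key g x ys" if "set ys \<subseteq> insert x (set xs)" for ys
    using that by (induction ys) (use Cons.prems in \<open>auto\<close>)
  show ?case using Cons ins[of "sort_key g xs"] by auto
qed simp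

lemma sorted_wrt_sort_key_inj:
  fixes T :: "'a \<Rightarrow> real"
  assumes "inj_on T (set xs)" "distinct xs"
  shows "sorted_wrt (\<lambda>i j. T i < T j) (sort_key T xs)"
proof -
  have "sorted (map T (sort_key T xs))" "distinct (map T (sort_key T xs))"
    using assms by (auto simp: distinct_map)
  then have "sorted_wrt (<) (map T (sort_key T xs))"
    by (simp add: strict_sorted_iff)
  then show ?thesis by (simp add: sorted_wrt_map)
qed

context finite_matroid
begin

definition addable :: "nat set \<Rightarrow> nat \<Rightarrow> bool" where
  "addable A i \<longleftrightarrow> i \<notin> A \<and> indep (insert i A)"

text \<open>\<open>\<theta> t i A\<close> is the price asked for element \<open>i\<close> at time \<open>t\<close> when \<open>A\<close> has been selected.\<close>

definition step :: "(real \<Rightarrow> nat \<Rightarrow> nat set \<Rightarrow> real) \<Rightarrow> (nat \<Rightarrow> real) \<Rightarrow> (nat \<Rightarrow> real) \<Rightarrow> nat \<Rightarrow> nat set \<Rightarrow> nat set" where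
  "step \<theta> T v i A = (if addable A i \<and> \<theta> (T i) i A \<le> v i then insert i A else A)"

text \<open>\<open>Q\<close> says which elements take part: arrivals before \<open>t\<close> give
  the state at time \<open>t\<close>, and excluding \<open>i\<close> gives the process in which
  \<open>i\<close> never arrives.\<close>

definition run :: "(real \<Rightarrow> nat \<Rightarrow> nat set \<Rightarrow> real) \<Rightarrow> (nat \<Rightarrow> real) \<Rightarrow> (nat \<Rightarrow> real) \<Rightarrow> (nat \<Rightarrow> bool) \<Rightarrow> nat set" where
  "run \<theta> T v Q = fold (step \<theta> T v) (sort_key T (filter Q [0..<n])) {}"

lemma fold_step_indep: "indep A \<Longrightarrow> indep (fold (step \<theta> T v) xs A)"
  by (induction xs arbitrary: A) (auto simp: step_def addable_def)

lemma indep_run: "indep (run \<theta> T v Q)"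
  unfolding run_def by (intro fold_step_indep indep_empty)

lemma run_telescope:
  fixes H :: "nat set \<Rightarrow> real"
  assumes "inj_on T {..<n}"
  shows "H (run \<theta> T v Q) - H {} =
    (\<Sum>i | i < n \<and> Q i. H (step \<theta> T v i (run \<theta> T v (\<lambda>j. Q j \<and> T j < T i))) - H (run \<theta> T v (\<lambda>j. Q j \<and> T j < T i)))"
proof -
  let ?xs = "sort_key T (filter Q [0..<n])"
  have "sorted_wrt (\<lambda>i j. T i < T j) ?xs"
    using assms by (intro sorted_wrt_sort_key_inj) (auto simp: inj_on_def)
  moreover have "filter (\<lambda>j. T j < T i) ?xs = sort_key T (filter (\<lambda>j. Q j \<and> T j < T i) [0..<n])" for i
    by (simp add: filter_sort conj_commute)
  moreover have "set ?xs = {i. i < n \<and> Q i}" by auto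
  ultimately show ?thesis
    using fold_telescope[of T ?xs H "step \<theta> T v" "{}"] unfolding run_def by simp
qed

lemma fold_step_mono: "A \<subseteq> fold (step \<theta> T v) xs A"
proof (induction xs arbitrary: A)
  case (Cons x xs)
  have "A \<subseteq> step \<theta> T v x A" by (auto simp: step_def)
  then show ?case using Cons by fastforce
qed simp

text \<open>A rejected element leaves the state as it was, so later decisions cannot depend on its
  value or its time.\<close>

lemma fold_step_filter_unselected:
  "i \<notin> fold (step \<theta> T v) xs A \<Longrightarrow> fold (step \<theta> T v) xs A = fold (step \<theta> T v) (filter (\<lambda>j. j \<noteq> i) xs) A"
proof (induction xs arbitrary: A)
  case (Cons x xs)
  have "i \<notin> step \<theta> T v x A"
    using Cons.prems fold_step_mono[of "step \<theta> T v x A" \<theta> T v xs] by auto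
  then have "x = i \<Longrightarrow> step \<theta> T v x A = A" by (auto simp: step_def)
  then show ?case using Cons by auto
qed simp

lemma run_unselected:
  "i \<notin> run \<theta> T v Q \<Longrightarrow> run \<theta> T v Q = run \<theta> T v (\<lambda>j. Q j \<and> j \<noteq> i)"
  using fold_step_filter_unselected[of i \<theta> T v "sort_key T (filter Q [0..<n])" "{}"]
  unfolding run_def by (simp add: filter_sort conj_commute)

lemma run_cong:
  assumes "\<And>j. j < n \<Longrightarrow> Q j = Q' j"
    and "\<And>j. j < n \<Longrightarrow> Q j \<Longrightarrow> T j = T' j" "\<And>j. j < n \<Longrightarrow> Q j \<Longrightarrow> v j = v' j"
  shows "run \<theta> T v Q = run \<theta> T' v' Q'"
proof -
  have "filter Q [0..<n] = filter Q' [0..<n]" using assms(1) by (intro filter_cong) auto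
  moreover have "sort_key T (filter Q [0..<n]) = sort_key T' (filter Q [0..<n])"
    using assms(2) by (intro sort_key_cong_on) auto
  moreover have "fold (step \<theta> T v) xs A = fold (step \<theta> T' v') xs A"
    if "set xs \<subseteq> {j. j < n \<and> Q j}" for xs A
    using that assms by (intro fold_cong refl ext) (auto simp: step_def)
  ultimately show ?thesis unfolding run_def by (metis (no_types, lifting) atLeast_upt lessThan_iff mem_Collect_eq set_filter set_sort subsetI)
qed

text \<open>Every intermediate list and set ranges over deterministic values, so measurability is proved with a
  continuation \<open>F\<close>; this avoids a measurable structure on sets of natural numbers.\<close>

lemma measurable_run:
  assumes T: "\<And>j. j < n \<Longrightarrow> (\<lambda>\<omega>. T \<omega> j) \<in> borel_measurable M"
    and v: "\<And>j. j < n \<Longrightarrow> (\<lambda>\<omega>. v \<omega> j) \<in> borel_measurable M"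
    and Q: "\<And>j. j < n \<Longrightarrow> Measurable.pred M (\<lambda>\<omega>. Q \<omega> j)"
    and \<theta>: "\<And>i A. (\<lambda>t. \<theta> t i A) \<in> borel_measurable borel"
    and F: "\<And>B. F B \<in> measurable M N"
  shows "(\<lambda>\<omega>. F (run \<theta> (T \<omega>) (v \<omega>) (Q \<omega>)) \<omega>) \<in> measurable M N"
proof -
  have m_fold: "(\<lambda>\<omega>. F (fold (step \<theta> (T \<omega>) (v \<omega>)) ys A) \<omega>) \<in> measurable M N"
    if "set ys \<subseteq> {..<n}" for ys A
    using that
  proof (induction ys arbitrary: A)
    case (Cons y ys)
    then have y: "y < n" by simp
    have [measurable]: "(\<lambda>\<omega>. \<theta> (T \<omega> y) y A) \<in> borel_measurable M" "(\<lambda>\<omega>. v \<omega> y) \<in> borel_measurable M"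
      using measurable_compose[OF T[OF y] \<theta>] v[OF y] by auto
    have "(\<lambda>\<omega>. if addable A y \<and> \<theta> (T \<omega> y) y A \<le> v \<omega> y
        then F (fold (step \<theta> (T \<omega>) (v \<omega>)) ys (insert y A)) \<omega>
        else F (fold (step \<theta> (T \<omega>) (v \<omega>)) ys A) \<omega>) \<in> measurable M N"
      using Cons by (intro measurable_If) auto
    then show ?case by (rule measurable_cong[THEN iffD1, rotated]) (auto simp: step_def[of _ _ _ y])
  qed (use F in simp)
  have m_insort: "(\<lambda>\<omega>. G (insort_key (T \<omega>) x ys) \<omega>) \<in> measurable M N"
    if "set ys \<subseteq> {..<n}" "x < n" "\<And>zs. set zs \<subseteq> {..<n} \<Longrightarrow> G zs \<in> measurable M N" for x ys G
    using that
  proof (induction ys arbitrary: G)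
    case (Cons y ys)
    have [measurable]: "(\<lambda>\<omega>. T \<omega> x) \<in> borel_measurable M" "(\<lambda>\<omega>. T \<omega> y) \<in> borel_measurable M"
      using T Cons.prems by auto
    have "(\<lambda>\<omega>. if T \<omega> x \<le> T \<omega> y then G (x # y # ys) \<omega> else G (y # insort_key (T \<omega>) x ys) \<omega>) \<in> measurable M N"
      using Cons.prems Cons.IH[of "\<lambda>zs. G (y # zs)"] by (intro measurable_If) auto
    then show ?case by (rule measurable_cong[THEN iffD1, rotated]) auto
  qed simp
  have m_sort: "(\<lambda>\<omega>. G (sort_key (T \<omega>) xs) \<omega>) \<in> measurable M N"
    if "set xs \<subseteq> {..<n}" "\<And>zs. set zs \<subseteq> {..<n} \<Longrightarrow> G zs \<in> measurable M N" for xs G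
    using that
  proof (induction xs arbitrary: G)
    case (Cons x xs)
    have "(\<lambda>\<omega>. G (insort_key (T \<omega>) x (sort_key (T \<omega>) xs)) \<omega>) \<in> measurable M N"
      by (rule Cons.IH[of "\<lambda>zs \<omega>. G (insort_key (T \<omega>) x zs) \<omega>"])
        (use Cons.prems in \<open>auto intro: m_insort[of _ x G]\<close>)
    then show ?case by simp
  qed simp
  have m_filter: "(\<lambda>\<omega>. G (filter (Q \<omega>) xs) \<omega>) \<in> measurable M N"
    if "set xs \<subseteq> {..<n}" "\<And>zs. set zs \<subseteq> {..<n} \<Longrightarrow> G zs \<in> measurable M N" for xs G
    using that
  proof (induction xs arbitrary: G)
    case (Cons x xs)
    have [measurable]: "Measurable.pred M (\<lambda>\<omega>. Q \<omega> x)" using Q Cons.prems by auto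
    have "(\<lambda>\<omega>. if Q \<omega> x then G (x # filter (Q \<omega>) xs) \<omega> else G (filter (Q \<omega>) xs) \<omega>) \<in> measurable M N"
      using Cons.prems Cons.IH[of "\<lambda>zs. G (x # zs)"] Cons.IH[of G] by (intro measurable_If) auto
    then show ?case by (rule measurable_cong[THEN iffD1, rotated]) auto
  qed simp
  show ?thesis unfolding run_def
    by (rule m_filter[of _ "\<lambda>xs \<omega>. F (fold (step \<theta> (T \<omega>) (v \<omega>)) (sort_key (T \<omega>) xs) {}) \<omega>"])
      (auto intro!: m_sort[of _ "\<lambda>ys \<omega>. F (fold (step \<theta> (T \<omega>) (v \<omega>)) ys {}) \<omega>"] m_fold)
qed

end

section \<open>Uniform arrival times\<close>

lemma borel_measurable_component:
  assumes "i \<in> I" "sets (M i) = sets borel"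
  shows "(\<lambda>z. z i) \<in> borel_measurable (PiM I M)"
  using measurable_component_singleton[OF assms(1), of M]
    measurable_cong_sets[OF refl assms(2), of "PiM I M"] by simp

text \<open>Fubini for coordinate \<open>i\<close>: overwriting it with an independent draw
  preserves the law. Both sides integrate over the full product, so applications need not split the
  index set.\<close>

lemma (in product_prob_space) nn_integral_PiM_resample:
  assumes I: "finite I" and i: "i \<in> I" and f: "f \<in> borel_measurable (PiM I M)"
  shows "(\<integral>\<^sup>+z. f z \<partial>(PiM I M)) = (\<integral>\<^sup>+z. \<integral>\<^sup>+x. f (z(i := x)) \<partial>(M i) \<partial>(PiM I M))"
proof -
  define J where "J = I - {i}"
  have J: "finite J" "i \<notin> J" "insert i J = I" using I i unfolding J_def by auto
  have upd: "(\<lambda>(z, x). z(i := x)) \<in> measurable (PiM I M \<Otimes>\<^sub>M M i) (PiM I M)"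
    using measurable_add_dim[of i I M] i by (simp add: insert_absorb)
  have "(\<lambda>zx. f (case zx of (z, x) \<Rightarrow> z(i := x))) \<in> borel_measurable (PiM I M \<Otimes>\<^sub>M M i)"
    by (rule measurable_compose[OF upd f])
  then have g: "(\<lambda>z. \<integral>\<^sup>+x. f (z(i := x)) \<partial>(M i)) \<in> borel_measurable (PiM I M)"
    by (intro M.borel_measurable_nn_integral) (simp add: split_def)
  have "(\<integral>\<^sup>+z. \<integral>\<^sup>+x. f (z(i := x)) \<partial>(M i) \<partial>(PiM I M))
      = (\<integral>\<^sup>+z. \<integral>\<^sup>+y. \<integral>\<^sup>+x. f ((z(i := y))(i := x)) \<partial>(M i) \<partial>(M i) \<partial>(PiM J M))"
    using product_nn_integral_insert[OF J(1,2), of "\<lambda>z. \<integral>\<^sup>+x. f (z(i := x)) \<partial>(M i)"] g J(3) by simp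
  \<comment> \<open>The draw \<open>y\<close> is overwritten by \<open>x\<close>, so a constant is
    integrated against a probability measure.\<close>
  also have "\<dots> = (\<integral>\<^sup>+z. \<integral>\<^sup>+x. f (z(i := x)) \<partial>(M i) \<partial>(PiM J M))"
    by (simp add: M.emeasure_space_1)
  also have "\<dots> = (\<integral>\<^sup>+z. f z \<partial>(PiM I M))"
    using product_nn_integral_insert[OF J(1,2), of f] f J(3) by simp
  finally show ?thesis by simp
qed

definition unif :: "real measure" where
  "unif = uniform_measure lborel {0..1}"

lemma sets_unif [measurable_cong, simp]: "sets unif = sets borel"
  unfolding unif_def by simp

lemma space_unif [simp]: "space unif = UNIV"
  unfolding unif_def by simp

lemma prob_space_unif: "prob_space unif"
  unfolding unif_def by (rule prob_space_uniform_measure) auto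

lemma nn_integral_unif:
  "f \<in> borel_measurable borel \<Longrightarrow> (\<integral>\<^sup>+t. f t \<partial>unif) = (\<integral>\<^sup>+t. f t * indicator {0..1} t \<partial>lborel)"
  unfolding unif_def by (simp add: nn_integral_uniform_measure divide_ennreal_def)

lemma AE_unif: "(AE t in lborel. t \<in> {0..1} \<longrightarrow> P t) \<Longrightarrow> (AE t in unif. P t)"
  unfolding unif_def by (rule AE_uniform_measureI) auto

interpretation unif: prob_space unif
  by (rule prob_space_unif)

interpretation unif_prod: product_prob_space "\<lambda>_::nat. unif" I for I
  by unfold_locales

text \<open>The solution of \<open>\<alpha>' = \<alpha> - 1\<close>, \<open>\<alpha>(1) = 0\<close>.\<close>

definition discount :: "real \<Rightarrow> real" where
  "discount t = 1 - exp (t - 1)"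

lemma discount_nonneg: "t \<le> 1 \<Longrightarrow> 0 \<le> discount t"
  unfolding discount_def by simp

lemma discount_borel [measurable]: "discount \<in> borel_measurable borel"
  unfolding discount_def[abs_def] by measurable

text \<open>As \<open>exp (t - 1) = 1 - discount t\<close>, this is the integral equation for
  \<open>discount\<close>. The interval is open at \<open>s\<close> because the state at time
  \<open>t\<close> counts only arrivals strictly before \<open>t\<close>.\<close>

lemma nn_integral_exp_eq_discount:
  assumes s: "0 \<le> s" "s \<le> 1" and c: "0 \<le> c"
  shows "(\<integral>\<^sup>+t. ennreal (exp (t - 1) * c) * indicator {s<..} t \<partial>unif) = ennreal (discount s * c)"
proof -
  have "(\<integral>\<^sup>+t. ennreal (exp (t - 1) * c) * indicator {s<..} t \<partial>unif)
      = (\<integral>\<^sup>+t. ennreal (exp (t - 1) * c) * indicator {s<..} t * indicator {0..1} t \<partial>lborel)"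
    by (rule nn_integral_unif) measurable
  also have "\<dots> = (\<integral>\<^sup>+t. ennreal (exp (t - 1) * c) * indicator {s..1} t \<partial>lborel)"
  proof (rule nn_integral_cong_AE)
    show "AE t in lborel. ennreal (exp (t - 1) * c) * indicator {s<..} t * indicator {0..1} t
        = ennreal (exp (t - 1) * c) * indicator {s..1} t"
      using AE_lborel_singleton[of s] by eventually_elim (use s in \<open>auto split: split_indicator\<close>)
  qed
  also have "\<dots> = ennreal (exp (1 - 1) * c - exp (s - 1) * c)"
    by (rule nn_integral_FTC_Icc)
      (use s c in \<open>auto intro!: derivative_eq_intros simp flip: has_real_derivative_iff_has_vector_derivative\<close>)
  finally show ?thesis by (simp add: discount_def algebra_simps)
qed

lemma nn_integral_exp_unif:
  assumes c: "0 \<le> c"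
  shows "(\<integral>\<^sup>+t. ennreal (exp (t - 1) * c) \<partial>unif) = ennreal (discount 0 * c)"
proof -
  have "AE t in unif. ennreal (exp (t - 1) * c) = ennreal (exp (t - 1) * c) * indicator {0<..} t"
    using AE_lborel_singleton[of "0::real"] by (intro AE_unif) (auto elim!: eventually_mono)
  then have "(\<integral>\<^sup>+t. ennreal (exp (t - 1) * c) \<partial>unif)
      = (\<integral>\<^sup>+t. ennreal (exp (t - 1) * c) * indicator {0<..} t \<partial>unif)"
    by (rule nn_integral_cong_AE)
  then show ?thesis using nn_integral_exp_eq_discount[of 0 c] c by simp
qed

lemma AE_unif_prod_good:
  "AE T in PiM {..<n} (\<lambda>_::nat. unif). inj_on T {..<n} \<and> (\<forall>i<n. 0 \<le> T i \<and> T i \<le> 1)"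
proof -
  let ?P = "PiM {..<n} (\<lambda>_::nat. unif)"
  have bounds: "AE T in ?P. \<forall>i\<in>{..<n}. 0 \<le> T i \<and> T i \<le> 1"
  proof (subst AE_finite_all, simp, intro ballI)
    fix i assume "i \<in> {..<n}"
    then show "AE T in ?P. 0 \<le> T i \<and> T i \<le> 1"
      by (intro AE_PiM_component) (auto simp: prob_space_unif intro!: AE_unif)
  qed
  \<comment> \<open>Resample \<open>T i\<close> with \<open>T j\<close> held fixed: a uniform time
    hits a given point with probability 0.\<close>
  have neq: "AE T in ?P. T i \<noteq> T j" if ij: "i < n" "j < n" "i \<noteq> j" for i j
  proof -
    have [measurable]: "(\<lambda>T. T i) \<in> borel_measurable ?P" "(\<lambda>T. T j) \<in> borel_measurable ?P"
      using ij by (auto intro!: borel_measurable_component)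
    let ?e = "\<lambda>T :: nat \<Rightarrow> real. if T i = T j then 1 else 0 :: ennreal"
    have e: "?e \<in> borel_measurable ?P" by measurable
    have z: "(\<integral>\<^sup>+x. (if x = y then 1 else 0) \<partial>unif) = 0" for y :: real
    proof -
      have "AE x in unif. x \<noteq> y"
        by (rule AE_unif) (use AE_lborel_singleton[of y] in \<open>auto elim: eventually_mono\<close>)
      then have "(\<integral>\<^sup>+x. (if x = y then 1 else 0) \<partial>unif) = (\<integral>\<^sup>+x. 0 \<partial>unif)"
        by (intro nn_integral_cong_AE) (auto elim: eventually_mono)
      then show ?thesis by simp
    qed
    have "(\<integral>\<^sup>+T. ?e T \<partial>?P) = (\<integral>\<^sup>+T. \<integral>\<^sup>+x. ?e (T(i := x)) \<partial>unif \<partial>?P)"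
      by (rule unif_prod.nn_integral_PiM_resample) (use ij e in auto)
    also have "\<dots> = 0" using ij z by simp
    finally have "AE T in ?P. ?e T = 0" using nn_integral_0_iff_AE[OF e] by simp
    then show ?thesis by (rule eventually_mono) (simp split: if_splits)
  qed
  have "AE T in ?P. \<forall>i\<in>{..<n}. \<forall>j\<in>{..<n}. i \<noteq> j \<longrightarrow> T i \<noteq> T j"
    by (subst AE_finite_all, simp, intro ballI, subst AE_finite_all, simp, intro ballI) (use neq in auto)
  with bounds show ?thesis
    by eventually_elim (auto simp: inj_on_def)
qed

section \<open>Prices and the pathwise balance\<close>

text \<open>\<open>opt_finite\<close> makes every expected residual a real number, so that prices
  can be formed by subtraction. The conditions on \<open>D i\<close> range over all \<open>i\<close>
  to fit the product space locale; the theorem fills in point masses beyond the ground set.\<close>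

locale prophet_matroid = finite_matroid +
  fixes D :: "nat \<Rightarrow> real measure"
  assumes prob_space_D: "\<And>i. prob_space (D i)"
    and sets_D [measurable_cong]: "\<And>i. sets (D i) = sets borel"
    and opt_finite: "(\<integral>\<^sup>+v. ennreal (residual {} v) \<partial>PiM {..<n} D) < \<infinity>"
begin

sublocale D: product_prob_space D "{..<n}"
  using prob_space_D by (auto simp: product_prob_space_def product_prob_space_axioms_def product_sigma_finite_def
      intro: prob_space_imp_sigma_finite)

abbreviation P :: "(nat \<Rightarrow> real) measure" where "P \<equiv> PiM {..<n} D"

lemma component_P: "i < n \<Longrightarrow> (\<lambda>v. v i) \<in> borel_measurable P"
  by (rule borel_measurable_component) (auto simp: sets_D)

lemma residual_measurable [measurable]: "residual A \<in> borel_measurable P"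
proof -
  have "(\<lambda>v. Max ((\<lambda>S. \<Sum>i\<in>S. v i) ` completions A)) \<in> borel_measurable P"
    by (intro borel_measurable_Max borel_measurable_sum finite_completions component_P)
      (use completions_ground in blast)
  then show ?thesis unfolding residual_def[abs_def] .
qed

lemma residual_integrable: "indep A \<Longrightarrow> integrable P (residual A)"
proof (rule integrableI_bounded)
  assume A: "indep A"
  have "(\<integral>\<^sup>+v. ennreal (norm (residual A v)) \<partial>P) \<le> (\<integral>\<^sup>+v. ennreal (residual {} v) \<partial>P)"
    using residual_mono[of "{}" A] residual_nonneg[OF A] A by (intro nn_integral_mono ennreal_leI) auto
  then show "(\<integral>\<^sup>+v. ennreal (norm (residual A v)) \<partial>P) < \<infinity>" using opt_finite by simp
qed simp

definition exp_residual :: "nat set \<Rightarrow> real" where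
  "exp_residual A = (\<integral>v. residual A v \<partial>P)"

definition price :: "real \<Rightarrow> nat \<Rightarrow> nat set \<Rightarrow> real" where
  "price t i A = discount t * (exp_residual A - exp_residual (insert i A))"

lemma exp_residual_nonneg: "indep A \<Longrightarrow> 0 \<le> exp_residual A"
  unfolding exp_residual_def by (intro integral_nonneg_AE) (auto simp: residual_nonneg)

lemma exp_residual_mono: "A \<subseteq> B \<Longrightarrow> indep B \<Longrightarrow> exp_residual B \<le> exp_residual A"
  unfolding exp_residual_def
  by (intro integral_mono residual_integrable residual_mono) (auto intro: indep_subset)

lemma nn_integral_residual: "indep A \<Longrightarrow> (\<integral>\<^sup>+v. ennreal (residual A v) \<partial>P) = ennreal (exp_residual A)"
  unfolding exp_residual_def
  by (intro nn_integral_eq_integral residual_integrable) (auto simp: residual_nonneg)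

text \<open>The pathwise bound holds for any completion \<open>S\<close>, optimal or not. Hence
  \<open>S\<close> may be held fixed while fresh values are averaged.\<close>

lemma sum_exp_residual_drop:
  assumes S: "S \<in> completions A"
  shows "(\<Sum>i\<in>S. exp_residual A - exp_residual (insert i A)) \<le> exp_residual A"
proof -
  have ind: "indep (S \<union> A)" using S unfolding completions_def by simp
  have A: "indep A" by (rule indep_subset[OF ind]) auto
  have ins: "indep (insert i A)" if "i \<in> S" for i
    by (rule indep_subset[OF ind]) (use that in auto)
  note int = residual_integrable[OF A] residual_integrable[OF ins]
  have "(\<Sum>i\<in>S. exp_residual A - exp_residual (insert i A))
      = (\<integral>v. (\<Sum>i\<in>S. residual A v - residual (insert i A) v) \<partial>P)"
    unfolding exp_residual_def by (subst Bochner_Integration.integral_sum)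
      (auto intro!: int sum.cong Bochner_Integration.integral_diff[symmetric])
  also have "\<dots> \<le> exp_residual A"
    unfolding exp_residual_def
    by (intro integral_mono) (auto intro!: int sum_residual_drop_completion[OF S])
  finally show ?thesis .
qed

text \<open>The utility of a buyer facing the price: \<open>ennreal\<close> sends a negative
  difference to 0, which is the outcome of declining.\<close>

definition surplus :: "nat \<Rightarrow> real \<Rightarrow> real \<Rightarrow> nat set \<Rightarrow> ennreal" where
  "surplus i t x A = (if addable A i then ennreal (x - price t i A) else 0)"

definition gain :: "nat \<Rightarrow> real \<Rightarrow> nat set \<Rightarrow> ennreal" where
  "gain i t A = (\<integral>\<^sup>+x. surplus i t x A \<partial>D i)"

lemma price_borel [measurable]: "(\<lambda>t. price t i A) \<in> borel_measurable borel"
  unfolding price_def by measurable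

lemma surplus_borel [measurable (raw)]:
  assumes [measurable]: "f \<in> borel_measurable M" "g \<in> borel_measurable M"
  shows "(\<lambda>z. surplus i (f z) (g z) A) \<in> borel_measurable M"
  unfolding surplus_def by measurable

lemma gain_borel [measurable]: "(\<lambda>t. gain i t A) \<in> borel_measurable borel"
  unfolding gain_def by (intro D.M.borel_measurable_nn_integral) measurable

lemma nn_integral_surplus:
  assumes "i < n"
  shows "(\<integral>\<^sup>+v. surplus i t (v i) A \<partial>P) = gain i t A"
proof -
  have "(\<lambda>v. surplus i t (v i) A) \<in> borel_measurable P"
    using component_P[OF assms] by measurable
  then have "(\<integral>\<^sup>+v. surplus i t (v i) A \<partial>P) = (\<integral>\<^sup>+v. \<integral>\<^sup>+x. surplus i t x A \<partial>D i \<partial>P)"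
    using D.nn_integral_PiM_resample[of i "\<lambda>v. surplus i t (v i) A"] assms by simp
  then show ?thesis unfolding gain_def by (simp add: D.P.emeasure_space_1)
qed

text \<open>For values \<open>v\<close>, the elements of an optimal completion of \<open>A\<close>
  are all addable and together cost at most \<open>discount t * exp_residual A\<close>. Their
  surpluses cover the rest of \<open>residual A v\<close>, and averaging over \<open>v\<close>
  leaves the factor \<open>1 - discount t = exp (t - 1)\<close>.\<close>

lemma sum_gain_ge:
  assumes A: "indep A" and t: "t \<le> 1"
  shows "ennreal (exp (t - 1) * exp_residual A) \<le> (\<Sum>i<n. gain i t A)"
proof -
  have R: "0 \<le> exp_residual A" using exp_residual_nonneg[OF A] .
  have pw: "ennreal (residual A v) \<le> ennreal (discount t * exp_residual A) + (\<Sum>i<n. surplus i t (v i) A)" for v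
  proof -
    obtain S where S: "S \<in> completions A" "residual A v = (\<Sum>i\<in>S. v i)"
      using residual_attained[OF A] by blast
    have add: "addable A i" if "i \<in> S" for i
    proof -
      have "indep (insert i A)" by (rule indep_subset[of "S \<union> A"]) (use S that in \<open>auto simp: completions_def\<close>)
      then show ?thesis using S that unfolding completions_def addable_def by auto
    qed
    \<comment> \<open>\<open>S\<close> depends on \<open>v\<close>, but the bound on its total price
      is the same for every completion.\<close>
    have "(\<Sum>i\<in>S. price t i A) = discount t * (\<Sum>i\<in>S. exp_residual A - exp_residual (insert i A))"
      unfolding price_def by (simp add: sum_distrib_left)
    also have "\<dots> \<le> discount t * exp_residual A"
      using sum_exp_residual_drop[OF S(1)] discount_nonneg[OF t] by (intro mult_left_mono) auto
    finally have "residual A v \<le> discount t * exp_residual A + (\<Sum>i\<in>S. v i - price t i A)"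
      using S by (simp add: sum_subtractf)
    also have "\<dots> \<le> discount t * exp_residual A + (\<Sum>i\<in>S. max 0 (v i - price t i A))"
      by (intro add_left_mono sum_mono) auto
    finally have "ennreal (residual A v) \<le> ennreal (discount t * exp_residual A + (\<Sum>i\<in>S. max 0 (v i - price t i A)))"
      by (rule ennreal_leI)
    also have "\<dots> = ennreal (discount t * exp_residual A) + (\<Sum>i\<in>S. surplus i t (v i) A)"
      using R discount_nonneg[OF t] add
      by (auto simp: ennreal_plus sum_nonneg surplus_def max_def ennreal_neg intro!: sum.cong simp flip: sum_ennreal)
    also have "\<dots> \<le> ennreal (discount t * exp_residual A) + (\<Sum>i<n. surplus i t (v i) A)"
      using completions_ground[OF S(1)] by (intro add_left_mono sum_mono2) auto
    finally show ?thesis .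
  qed
  have [measurable]: "(\<lambda>v. surplus i t (v i) A) \<in> borel_measurable P" if "i < n" for i
    using component_P[OF that] by measurable
  have "ennreal (discount t * exp_residual A) + ennreal (exp (t - 1) * exp_residual A) = ennreal (exp_residual A)"
    using R discount_nonneg[OF t]
    by (subst ennreal_plus[symmetric]) (auto simp: discount_def left_diff_distrib mult_left_le_one_le)
  also have "\<dots> \<le> (\<integral>\<^sup>+v. ennreal (discount t * exp_residual A) + (\<Sum>i<n. surplus i t (v i) A) \<partial>P)"
    using pw by (subst nn_integral_residual[OF A, symmetric]) (intro nn_integral_mono)
  also have "\<dots> = ennreal (discount t * exp_residual A) + (\<integral>\<^sup>+v. (\<Sum>i<n. surplus i t (v i) A) \<partial>P)"
    by (subst nn_integral_add) (auto simp: D.P.emeasure_space_1)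
  also have "(\<integral>\<^sup>+v. (\<Sum>i<n. surplus i t (v i) A) \<partial>P) = (\<Sum>i<n. gain i t A)"
    by (subst nn_integral_sum) (auto simp: nn_integral_surplus)
  finally show ?thesis by (simp add: ennreal_add_left_cancel_le)
qed

abbreviation run_price :: "(nat \<Rightarrow> real) \<Rightarrow> (nat \<Rightarrow> real) \<Rightarrow> (nat \<Rightarrow> bool) \<Rightarrow> nat set" where
  "run_price \<equiv> run price"

definition run_value :: "(nat \<Rightarrow> real) \<Rightarrow> (nat \<Rightarrow> real) \<Rightarrow> real" where
  "run_value T v = (\<Sum>i\<in>run_price T v (\<lambda>_. True). v i)"

text \<open>Welfare is utility plus revenue. Each payment is a drop of \<open>exp_residual\<close>
  weighted by the integral of \<open>exp (t - 1)\<close> over the times after the arrival; at time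
  \<open>t\<close> the drops so far sum to \<open>exp_residual {}\<close> minus the current
  residual. The integral stands on the left because subtraction in \<open>ennreal\<close>
  truncates.\<close>

lemma run_value_balance:
  assumes inj: "inj_on T {..<n}" and T: "\<And>i. i < n \<Longrightarrow> 0 \<le> T i \<and> T i \<le> 1"
  shows "ennreal (run_value T v) + (\<integral>\<^sup>+t. ennreal (exp (t - 1) * exp_residual (run_price T v (\<lambda>j. T j < t))) \<partial>unif)
    = (\<Sum>i<n. surplus i (T i) (v i) (run_price T v (\<lambda>j. T j < T i))) + ennreal (discount 0 * exp_residual {})"
proof -
  define pre where "pre i = run_price T v (\<lambda>j. T j < T i)" for i
  define \<Delta> where "\<Delta> i = exp_residual (pre i) - exp_residual (step price T v i (pre i))" for i
  define s where "s i = (if addable (pre i) i then max 0 (v i - price (T i) i (pre i)) else 0)" for i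
  have s0: "0 \<le> s i" for i unfolding s_def by auto
  have ind: "indep (pre i)" for i unfolding pre_def by (rule indep_run)
  have \<Delta>0: "0 \<le> \<Delta> i" for i
  proof -
    have "indep (step price T v i (pre i))" using ind unfolding step_def addable_def by auto
    moreover have "pre i \<subseteq> step price T v i (pre i)" by (auto simp: step_def)
    ultimately show ?thesis unfolding \<Delta>_def using exp_residual_mono by simp
  qed
  have d0: "0 \<le> discount (T i) * \<Delta> i" if "i < n" for i
    using discount_nonneg \<Delta>0 T[OF that] by simp
  have d1: "(\<Sum>i<n. ennreal (discount (T i) * \<Delta> i)) = ennreal (\<Sum>i<n. discount (T i) * \<Delta> i)"
    using d0 by (intro sum_ennreal) auto
  have d2: "0 \<le> (\<Sum>i<n. discount (T i) * \<Delta> i)" using d0 by (intro sum_nonneg) auto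
  have "run_value T v = (\<Sum>i<n. (\<Sum>j\<in>step price T v i (pre i). v j) - (\<Sum>j\<in>pre i. v j))"
    using run_telescope[OF inj, of "\<lambda>A. \<Sum>j\<in>A. v j" price v "\<lambda>_. True"]
    unfolding run_value_def pre_def by (simp add: lessThan_def)
  \<comment> \<open>An accepted element contributes its value, which is surplus plus price. For a
    rejected one both terms vanish.\<close>
  also have "\<dots> = (\<Sum>i<n. s i + discount (T i) * \<Delta> i)"
    using indep_finite[OF ind]
    by (intro sum.cong refl) (auto simp: step_def s_def \<Delta>_def price_def addable_def)
  finally have "ennreal (run_value T v) = (\<Sum>i<n. ennreal (s i)) + (\<Sum>i<n. ennreal (discount (T i) * \<Delta> i))"
    using s0 d1 d2 by (simp add: sum.distrib ennreal_plus sum_nonneg sum_ennreal)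
  moreover have "ennreal (s i) = surplus i (T i) (v i) (pre i)" for i
    unfolding s_def surplus_def by (auto simp: max_def ennreal_neg)
  moreover have "(\<Sum>i<n. ennreal (discount (T i) * \<Delta> i))
      + (\<integral>\<^sup>+t. ennreal (exp (t - 1) * exp_residual (run_price T v (\<lambda>j. T j < t))) \<partial>unif)
    = ennreal (discount 0 * exp_residual {})"
  proof -
    have m: "(\<lambda>t. ennreal (exp (t - 1) * exp_residual (run_price T v (\<lambda>j. T j < t)))) \<in> borel_measurable unif"
      by (rule measurable_run[where F = "\<lambda>B t. ennreal (exp (t - 1) * exp_residual B)"
            and T = "\<lambda>_. T" and v = "\<lambda>_. v" and Q = "\<lambda>t j. T j < t"]) measurable
    have m': "(\<lambda>t. \<Sum>i<n. ennreal (exp (t - 1) * \<Delta> i) * indicator {T i<..} t) \<in> borel_measurable unif"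
      by measurable
    have tel: "(\<Sum>i<n. ennreal (exp (t - 1) * \<Delta> i) * indicator {T i<..} t)
        + ennreal (exp (t - 1) * exp_residual (run_price T v (\<lambda>j. T j < t)))
        = ennreal (exp (t - 1) * exp_residual {})" for t
    proof -
      \<comment> \<open>For an element that arrived before \<open>t\<close>, the state it met does
        not depend on the cutoff \<open>t\<close>.\<close>
      have "run_price T v (\<lambda>j. T j < t \<and> T j < T i) = pre i" if "T i < t" for i
        unfolding pre_def by (rule run_cong) (use that in auto)
      then have "exp_residual {} - exp_residual (run_price T v (\<lambda>j. T j < t)) = (\<Sum>i | i < n \<and> T i < t. \<Delta> i)"
        using run_telescope[OF inj, of "\<lambda>A. - exp_residual A" price v "\<lambda>j. T j < t"]
        unfolding \<Delta>_def by simp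
      also have "\<dots> = (\<Sum>i<n. \<Delta> i * indicator {T i<..} t)"
        by (rule sum.mono_neutral_cong_left) auto
      finally have *: "exp_residual {} = (\<Sum>i<n. \<Delta> i * indicator {T i<..} t) + exp_residual (run_price T v (\<lambda>j. T j < t))"
        by simp
      have "(\<Sum>i<n. ennreal (exp (t - 1) * \<Delta> i) * indicator {T i<..} t)
          = (\<Sum>i<n. ennreal (exp (t - 1) * (\<Delta> i * indicator {T i<..} t)))"
        by (intro sum.cong refl) (auto split: split_indicator)
      also have "\<dots> = ennreal (exp (t - 1) * (\<Sum>i<n. \<Delta> i * indicator {T i<..} t))"
        unfolding sum_distrib_left using \<Delta>0 by (intro sum_ennreal) auto
      finally show ?thesis
        using \<Delta>0 exp_residual_nonneg[OF indep_run, of price T v "\<lambda>j. T j < t"]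
        by (simp add: * distrib_left ennreal_plus sum_nonneg)
    qed
    have "(\<Sum>i<n. ennreal (discount (T i) * \<Delta> i))
        = (\<Sum>i<n. \<integral>\<^sup>+t. ennreal (exp (t - 1) * \<Delta> i) * indicator {T i<..} t \<partial>unif)"
      using T \<Delta>0 by (intro sum.cong refl) (simp add: nn_integral_exp_eq_discount)
    also have "\<dots> = (\<integral>\<^sup>+t. (\<Sum>i<n. ennreal (exp (t - 1) * \<Delta> i) * indicator {T i<..} t) \<partial>unif)"
      by (rule nn_integral_sum[symmetric]) measurable
    finally have "(\<Sum>i<n. ennreal (discount (T i) * \<Delta> i))
        + (\<integral>\<^sup>+t. ennreal (exp (t - 1) * exp_residual (run_price T v (\<lambda>j. T j < t))) \<partial>unif)
        = (\<integral>\<^sup>+t. (\<Sum>i<n. ennreal (exp (t - 1) * \<Delta> i) * indicator {T i<..} t)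
            + ennreal (exp (t - 1) * exp_residual (run_price T v (\<lambda>j. T j < t))) \<partial>unif)"
      by (simp only: nn_integral_add[OF m' m])
    then show ?thesis
      using tel nn_integral_exp_unif[OF exp_residual_nonneg[OF indep_empty]] by simp
  qed
  ultimately show ?thesis unfolding pre_def by (simp add: add.assoc)
qed

end

section \<open>Expected value of the process\<close>

context prophet_matroid
begin

abbreviation PT :: "(nat \<Rightarrow> real) measure" where "PT \<equiv> PiM {..<n} (\<lambda>_. unif)"

lemma component_PT: "i < n \<Longrightarrow> (\<lambda>T. T i) \<in> borel_measurable PT"
  by (rule borel_measurable_component) auto

lemma run_value_measurable:
  assumes T: "\<And>j. j < n \<Longrightarrow> (\<lambda>z. T z j) \<in> borel_measurable M"
    and v: "\<And>j. j < n \<Longrightarrow> (\<lambda>z. v z j) \<in> borel_measurable M"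
  shows "(\<lambda>z. run_value (T z) (v z)) \<in> borel_measurable M"
proof -
  \<comment> \<open>\<open>measurable_run\<close> needs a measurable continuation for every set
    \<open>B\<close>, so indices outside the ground set are cut off.\<close>
  have F: "(\<lambda>z. \<Sum>i\<in>B \<inter> {..<n}. v z i) \<in> borel_measurable M" for B
    using v by (intro borel_measurable_sum) auto
  have "(\<lambda>z. \<Sum>i\<in>run_price (T z) (v z) (\<lambda>_. True) \<inter> {..<n}. v z i) \<in> borel_measurable M"
    by (rule measurable_run[where F = "\<lambda>B z. \<Sum>i\<in>B \<inter> {..<n}. v z i" and Q = "\<lambda>_ _. True"])
      (use T v F in auto)
  moreover have "run_price T v Q \<inter> {..<n} = run_price T v Q" for T v Q
    using indep_ground[OF indep_run] by blast
  ultimately show ?thesis unfolding run_value_def by simp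
qed

lemma state_measurable:
  assumes T: "\<And>j. j < n \<Longrightarrow> (\<lambda>z. T z j) \<in> borel_measurable M"
    and v: "\<And>j. j < n \<Longrightarrow> (\<lambda>z. v z j) \<in> borel_measurable M"
    and t: "t \<in> borel_measurable M"
    and F: "\<And>B. F B \<in> measurable M N"
  shows "(\<lambda>z. F (run_price (T z) (v z) (\<lambda>j. T z j < t z \<and> Q j)) z) \<in> measurable M N"
proof (rule measurable_run[where F = F])
  fix j assume j: "j < n"
  note [measurable] = T[OF j] t
  show "Measurable.pred M (\<lambda>z. T z j < t z \<and> Q j)" by measurable
qed (use T v F in auto)

text \<open>On the right, \<open>i\<close> meets the process run without \<open>i\<close>. The unconditional state at time \<open>t\<close> either contains
  \<open>i\<close>, so that its gain vanishes, or coincides with that state.\<close>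

lemma nn_integral_surplus_ge_gain:
  assumes i: "i < n"
  shows "(\<integral>\<^sup>+T. \<integral>\<^sup>+v. \<integral>\<^sup>+t. gain i t (run_price T v (\<lambda>j. T j < t)) \<partial>unif \<partial>P \<partial>PT)
    \<le> (\<integral>\<^sup>+T. \<integral>\<^sup>+v. surplus i (T i) (v i) (run_price T v (\<lambda>j. T j < T i)) \<partial>P \<partial>PT)"
proof -
  let ?W = "\<lambda>T v t. run_price T v (\<lambda>j. T j < t \<and> j \<noteq> i)"
  \<comment> \<open>\<open>?W\<close> reads neither \<open>T i\<close> nor \<open>v i\<close>, so
    both can be resampled with the state unchanged. Resampling the value turns the surplus into the
    gain.\<close>
  have W_upd: "?W (T(i := s)) v t = ?W T v t" "?W T (v(i := x)) t = ?W T v t" for T v s t x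
    by (rule run_cong; auto)+
  have W_self: "run_price T v (\<lambda>j. T j < T i) = ?W T v (T i)" for T v
    by (intro run_cong) auto
  have W_ge: "gain i t (run_price T v (\<lambda>j. T j < t)) \<le> gain i t (?W T v t)" for T v t
  proof (cases "i \<in> run_price T v (\<lambda>j. T j < t)")
    case True
    then show ?thesis by (simp add: gain_def surplus_def addable_def)
  next
    case False
    then show ?thesis using run_unselected[OF False] by simp
  qed
  have inner: "(\<integral>\<^sup>+v. surplus i (T i) (v i) (run_price T v (\<lambda>j. T j < T i)) \<partial>P)
      = (\<integral>\<^sup>+v. gain i (T i) (?W T v (T i)) \<partial>P)" for T
  proof -
    have "(\<lambda>v. surplus i (T i) (v i) (?W T v (T i))) \<in> borel_measurable P"
      by (rule state_measurable[where F = "\<lambda>B v. surplus i (T i) (v i) B" and T = "\<lambda>_. T" and t = "\<lambda>_. T i"])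
        (use component_P i in \<open>auto intro!: surplus_borel\<close>)
    then have "(\<integral>\<^sup>+v. surplus i (T i) (v i) (?W T v (T i)) \<partial>P)
        = (\<integral>\<^sup>+v. \<integral>\<^sup>+x. surplus i (T i) ((v(i := x)) i) (?W T (v(i := x)) (T i)) \<partial>D i \<partial>P)"
      using i by (intro D.nn_integral_PiM_resample) auto
    then show ?thesis unfolding W_upd W_self gain_def by simp
  qed
  have m3: "(\<lambda>z. gain i (t z) (?W (T z) (v z) (t z))) \<in> borel_measurable M"
    if "\<And>j. j < n \<Longrightarrow> (\<lambda>z. T z j) \<in> borel_measurable M" "\<And>j. j < n \<Longrightarrow> (\<lambda>z. v z j) \<in> borel_measurable M"
      "t \<in> borel_measurable M" for T v t and M :: "'z measure"
    by (rule state_measurable[where F = "\<lambda>B z. gain i (t z) B"])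
      (use that in \<open>auto intro: measurable_compose[OF _ gain_borel]\<close>)
  have outer_m: "(\<lambda>T. \<integral>\<^sup>+v. gain i (T i) (?W T v (T i)) \<partial>P) \<in> borel_measurable PT"
  proof (rule D.P.borel_measurable_nn_integral)
    have "(\<lambda>z. gain i (fst z i) (?W (fst z) (snd z) (fst z i))) \<in> borel_measurable (PT \<Otimes>\<^sub>M P)"
      using i by (intro m3) (auto intro: measurable_compose[OF measurable_fst component_PT]
          measurable_compose[OF measurable_snd component_P])
    then show "(\<lambda>(T, v). gain i (T i) (?W T v (T i))) \<in> borel_measurable (PT \<Otimes>\<^sub>M P)"
      by (simp add: split_def)
  qed
  \<comment> \<open>Resampling the arrival time of \<open>i\<close> yields a uniform
    \<open>t\<close> independent of the process without \<open>i\<close>; the order of the inner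
    integrals is then exchanged.\<close>
  have "(\<integral>\<^sup>+T. \<integral>\<^sup>+v. surplus i (T i) (v i) (run_price T v (\<lambda>j. T j < T i)) \<partial>P \<partial>PT)
      = (\<integral>\<^sup>+T. \<integral>\<^sup>+t. \<integral>\<^sup>+v. gain i ((T(i := t)) i) (?W (T(i := t)) v ((T(i := t)) i)) \<partial>P \<partial>unif \<partial>PT)"
    unfolding inner by (rule unif_prod.nn_integral_PiM_resample[OF _ _ outer_m]) (use i in auto)
  also have "\<dots> = (\<integral>\<^sup>+T. \<integral>\<^sup>+t. \<integral>\<^sup>+v. gain i t (?W T v t) \<partial>P \<partial>unif \<partial>PT)"
    unfolding W_upd fun_upd_same ..
  also have "\<dots> = (\<integral>\<^sup>+T. \<integral>\<^sup>+v. \<integral>\<^sup>+t. gain i t (?W T v t) \<partial>unif \<partial>P \<partial>PT)"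
  proof (rule nn_integral_cong)
    fix T
    interpret pair_sigma_finite P unif by unfold_locales
    have "(\<lambda>z. gain i (snd z) (?W T (fst z) (snd z))) \<in> borel_measurable (P \<Otimes>\<^sub>M unif)"
      by (intro m3) (auto intro: measurable_compose[OF measurable_fst component_P])
    then show "(\<integral>\<^sup>+t. \<integral>\<^sup>+v. gain i t (?W T v t) \<partial>P \<partial>unif) = (\<integral>\<^sup>+v. \<integral>\<^sup>+t. gain i t (?W T v t) \<partial>unif \<partial>P)"
      by (intro Fubini') (simp add: split_def)
  qed
  finally show ?thesis
    using W_ge by (simp only:) (intro nn_integral_mono)
qed

text \<open>Average \<open>run_value_balance\<close> over times and values. The expected surpluses
  \<open>Z\<close> dominate the expected \<open>Y\<close> by the charging argument and
  \<open>sum_gain_ge\<close>, and cancelling \<open>Y\<close> leaves the claim.\<close>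

lemma expected_run_value:
  "ennreal (discount 0 * exp_residual {}) \<le> (\<integral>\<^sup>+T. \<integral>\<^sup>+v. ennreal (run_value T v) \<partial>P \<partial>PT)"
proof -
  define Y where "Y T v = (\<integral>\<^sup>+t. ennreal (exp (t - 1) * exp_residual (run_price T v (\<lambda>j. T j < t))) \<partial>unif)" for T v
  define Z where "Z i T v = surplus i (T i) (v i) (run_price T v (\<lambda>j. T j < T i))" for i T v
  define c where "c = ennreal (discount 0 * exp_residual {})"
  have fst_PT: "(\<lambda>z. fst z j) \<in> borel_measurable (PT \<Otimes>\<^sub>M N)" if "j < n" for j and N :: "'z measure"
    by (rule measurable_compose[OF measurable_fst component_PT[OF that]])
  have snd_P: "(\<lambda>z. snd z j) \<in> borel_measurable (PT \<Otimes>\<^sub>M P)" if "j < n" for j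
    by (rule measurable_compose[OF measurable_snd component_P[OF that]])
  have X_m: "(\<lambda>(T, v). ennreal (run_value T v)) \<in> borel_measurable (PT \<Otimes>\<^sub>M P)"
    unfolding split_def using fst_PT snd_P by (intro measurable_compose[OF run_value_measurable]) auto
  have triple: "(\<lambda>z. F (snd z) (run_price (fst (fst z)) (snd (fst z)) (\<lambda>j. fst (fst z) j < snd z)))
      \<in> borel_measurable ((PT \<Otimes>\<^sub>M P) \<Otimes>\<^sub>M unif)"
    if F: "\<And>B. (\<lambda>t. F t B) \<in> borel_measurable borel" for F :: "real \<Rightarrow> nat set \<Rightarrow> ennreal"
    by (rule state_measurable[where F = "\<lambda>B z. F (snd z) B" and Q = "\<lambda>_. True", simplified])
      (use F fst_PT snd_P in \<open>auto intro: measurable_compose[OF measurable_fst] measurable_compose[OF _ F]\<close>)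
  have Y_m: "(\<lambda>(T, v). Y T v) \<in> borel_measurable (PT \<Otimes>\<^sub>M P)"
    unfolding Y_def split_def
    by (intro unif.borel_measurable_nn_integral)
      (use triple[of "\<lambda>t B. ennreal (exp (t - 1) * exp_residual B)"] in \<open>simp add: split_def\<close>)
  have Z_m: "(\<lambda>(T, v). Z i T v) \<in> borel_measurable (PT \<Otimes>\<^sub>M P)" if i: "i < n" for i
    unfolding Z_def split_def
    by (rule state_measurable[where F = "\<lambda>B z. surplus i (fst z i) (snd z i) B" and t = "\<lambda>z. fst z i"
          and Q = "\<lambda>_. True", simplified])
      (use fst_PT snd_P i in \<open>auto intro!: surplus_borel\<close>)
  have gain_m: "(\<lambda>((T, v), t). gain i t (run_price T v (\<lambda>j. T j < t))) \<in> borel_measurable ((PT \<Otimes>\<^sub>M P) \<Otimes>\<^sub>M unif)" for i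
    using triple[of "gain i"] by (simp add: split_def)
  let ?E = "\<lambda>f. \<integral>\<^sup>+T. \<integral>\<^sup>+v. f T v \<partial>P \<partial>PT"
  let ?N = "PT \<Otimes>\<^sub>M P"
  have E: "?E f = (\<integral>\<^sup>+z. f (fst z) (snd z) \<partial>?N)"
    if "(\<lambda>(T, v). f T v) \<in> borel_measurable ?N" for f :: "_ \<Rightarrow> _ \<Rightarrow> ennreal"
    using D.P.nn_integral_fst[OF that] by (simp add: split_def)
  have E_add: "?E (\<lambda>T v. f T v + g T v) = ?E f + ?E g"
    if "(\<lambda>(T, v). f T v) \<in> borel_measurable ?N" "(\<lambda>(T, v). g T v) \<in> borel_measurable ?N" for f g
    using that by (simp add: E split_def nn_integral_add)
  have E_sum: "?E (\<lambda>T v. \<Sum>i<n. f i T v) = (\<Sum>i<n. ?E (f i))"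
    if "\<And>i. i < n \<Longrightarrow> (\<lambda>(T, v). f i T v) \<in> borel_measurable ?N" for f
    using that by (simp add: E split_def) (intro nn_integral_sum, simp)
  have Y_le: "?E Y \<le> (\<Sum>i<n. ?E (Z i))"
  proof -
    let ?G = "\<lambda>i T v. \<integral>\<^sup>+t. gain i t (run_price T v (\<lambda>j. T j < t)) \<partial>unif"
    have G_m: "(\<lambda>(T, v). ?G i T v) \<in> borel_measurable ?N" for i
      unfolding split_def by (intro unif.borel_measurable_nn_integral) (use gain_m[of i] in \<open>simp add: split_def\<close>)
    have "Y T v \<le> (\<Sum>i<n. ?G i T v)" if z: "(T, v) \<in> space ?N" for T v
    proof -
      have "Y T v \<le> (\<integral>\<^sup>+t. (\<Sum>i<n. gain i t (run_price T v (\<lambda>j. T j < t))) \<partial>unif)"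
        unfolding Y_def by (rule nn_integral_mono_AE, rule AE_unif) (auto intro!: sum_gain_ge indep_run)
      also have "\<dots> = (\<Sum>i<n. ?G i T v)"
        using measurable_Pair2[OF gain_m z] by (intro nn_integral_sum) (simp add: split_def)
      finally show ?thesis .
    qed
    then have "?E Y \<le> ?E (\<lambda>T v. \<Sum>i<n. ?G i T v)"
      by (intro nn_integral_mono) (auto simp: space_pair_measure)
    also have "\<dots> = (\<Sum>i<n. ?E (?G i))" by (intro E_sum G_m)
    also have "\<dots> \<le> (\<Sum>i<n. ?E (Z i))"
      unfolding Z_def by (intro sum_mono nn_integral_surplus_ge_gain) auto
    finally show ?thesis .
  qed
  \<comment> \<open>Cancellation in \<open>ennreal\<close> requires a finite term; \<open>Y\<close>
    is bounded by \<open>exp_residual {}\<close>.\<close>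
  have "?E Y \<le> ?E (\<lambda>_ _. ennreal (exp_residual {}))"
  proof (intro nn_integral_mono)
    fix T v
    have "Y T v \<le> (\<integral>\<^sup>+t. ennreal (exp_residual {}) \<partial>unif)"
      unfolding Y_def
    proof (rule nn_integral_mono_AE, rule AE_unif, intro always_eventually allI impI ennreal_leI)
      fix t :: real assume "t \<in> {0..1}"
      then have "exp (t - 1) * exp_residual (run_price T v (\<lambda>j. T j < t)) \<le> 1 * exp_residual {}"
        by (intro mult_mono exp_residual_mono exp_residual_nonneg indep_run) auto
      then show "exp (t - 1) * exp_residual (run_price T v (\<lambda>j. T j < t)) \<le> exp_residual {}" by simp
    qed
    then show "Y T v \<le> ennreal (exp_residual {})" by (simp add: unif.emeasure_space_1[simplified])
  qed
  then have fin: "?E Y \<noteq> \<infinity>"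
    by (auto simp: D.P.emeasure_space_1 unif_prod.P.emeasure_space_1 top_unique)
  have "?E Y + c \<le> (\<Sum>i<n. ?E (Z i)) + c" using Y_le by (rule add_right_mono)
  also have "\<dots> = ?E (\<lambda>T v. (\<Sum>i<n. Z i T v) + c)"
    using Z_m by (subst E_add) (auto simp: E_sum split_def D.P.emeasure_space_1 unif_prod.P.emeasure_space_1)
  \<comment> \<open>The balance holds for distinct times in the unit interval, hence almost
    surely.\<close>
  also have "\<dots> = ?E (\<lambda>T v. ennreal (run_value T v) + Y T v)"
  proof (rule nn_integral_cong_AE)
    show "AE T in PT. (\<integral>\<^sup>+v. (\<Sum>i<n. Z i T v) + c \<partial>P) = (\<integral>\<^sup>+v. ennreal (run_value T v) + Y T v \<partial>P)"
      using AE_unif_prod_good[of n]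
      by eventually_elim (auto simp: Y_def Z_def c_def run_value_balance intro!: nn_integral_cong)
  qed
  also have "\<dots> = ?E Y + ?E (\<lambda>T v. ennreal (run_value T v))"
    using X_m Y_m by (subst E_add) (auto simp: add.commute)
  finally show ?thesis using fin unfolding c_def by (simp add: ennreal_add_left_cancel_le)
qed

end

section \<open>Derandomisation\<close>

text \<open>If \<open>f < c\<close> held at every point satisfying \<open>Q\<close>, it would hold
  almost surely, and the integral would fall strictly below the finite \<open>c\<close>. Carrying
  \<open>Q\<close> along yields a point that is also in general position.\<close>

lemma (in prob_space) exists_ge_nn_integral:
  assumes f [measurable]: "f \<in> borel_measurable M" and Q: "AE x in M. Q x"
    and c: "c \<le> (\<integral>\<^sup>+x. f x \<partial>M)" "c < \<infinity>"
  obtains x where "Q x" "c \<le> f x"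
proof (rule ccontr)
  assume "\<not> thesis"
  then have "\<And>x. Q x \<Longrightarrow> f x < c" using that by force
  with Q have lt: "AE x in M. f x < c" by (auto elim: eventually_mono)
  have "(\<integral>\<^sup>+x. f x \<partial>M) \<le> (\<integral>\<^sup>+x. c \<partial>M)"
    using lt by (intro nn_integral_mono_AE) (auto elim: eventually_mono)
  then have "(\<integral>\<^sup>+x. f x \<partial>M) \<noteq> \<infinity>" using c by (auto simp: emeasure_space_1 top_unique)
  moreover have "\<not> (AE x in M. c \<le> f x)"
  proof
    assume "AE x in M. c \<le> f x"
    with lt have "AE x in M. False" by eventually_elim auto
    then show False by simp
  qed
  ultimately have "(\<integral>\<^sup>+x. f x \<partial>M) < (\<integral>\<^sup>+x. c \<partial>M)"
    using lt by (intro nn_integral_less) (auto elim: eventually_mono)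
  then show False using c by (simp add: emeasure_space_1)
qed

section \<open>Online rules with a fixed list of times\<close>

definition taken :: "history \<Rightarrow> nat set" where
  "taken h = {i. \<exists>x. (i, x, True) \<in> set h}"

lemma taken_simps: "taken [] = {}" "taken (h @ [(i, x, b)]) = (if b then insert i (taken h) else taken h)"
  unfolding taken_def by auto

lemma selected_eq_taken: "selected A v \<sigma> = taken (run_alg A v \<sigma> [])"
  unfolding selected_def taken_def ..

context finite_matroid
begin

text \<open>The length of the history is the number of earlier arrivals, so the element in position
  \<open>k\<close>, counted from 0, is treated as arriving at time
  \<open>\<tau> ! k\<close>.\<close>

definition threshold_rule :: "(real \<Rightarrow> nat \<Rightarrow> nat set \<Rightarrow> real) \<Rightarrow> real list \<Rightarrow> online_rule" where
  "threshold_rule \<theta> \<tau> h i x \<longleftrightarrow> addable (taken h) i \<and> \<theta> (\<tau> ! length h) i (taken h) \<le> x"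

lemma taken_threshold_rule_indep:
  "indep (taken h) \<Longrightarrow> indep (taken (run_alg (threshold_rule \<theta> \<tau>) v \<sigma> h))"
  by (induction \<sigma> arbitrary: h) (auto simp: taken_simps threshold_rule_def addable_def)

lemma taken_threshold_rule:
  "(\<And>k. k < length \<sigma> \<Longrightarrow> T (\<sigma> ! k) = \<tau> ! (length h + k)) \<Longrightarrow>
    taken (run_alg (threshold_rule \<theta> \<tau>) v \<sigma> h) = fold (step \<theta> T v) \<sigma> (taken h)"
proof (induction \<sigma> arbitrary: h)
  case (Cons i \<sigma>)
  let ?h = "h @ [(i, v i, threshold_rule \<theta> \<tau> h i (v i))]"
  have "taken (run_alg (threshold_rule \<theta> \<tau>) v \<sigma> ?h) = fold (step \<theta> T v) \<sigma> (taken ?h)"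
  proof (rule Cons.IH)
    fix k assume "k < length \<sigma>"
    then show "T (\<sigma> ! k) = \<tau> ! (length ?h + k)" using Cons.prems[of "Suc k"] by simp
  qed
  moreover have "taken ?h = step \<theta> T v i (taken h)"
    using Cons.prems[of 0] by (simp add: taken_simps step_def threshold_rule_def)
  ultimately show ?case by simp
qed simp

text \<open>If the expected optimum is infinite, this bound yields one element of infinite mean.
  Loops are left out so that the element found can be selected.\<close>

lemma residual_le_sum_nonloops:
  "ennreal (residual {} v) \<le> (\<Sum>i | i < n \<and> indep {i}. ennreal (v i))"
proof -
  obtain S where S: "S \<in> completions {}" "residual {} v = (\<Sum>i\<in>S. v i)"
    using residual_attained[OF indep_empty] by blast
  have sub: "S \<subseteq> {i. i < n \<and> indep {i}}"
    using S indep_ground indep_subset[of S] unfolding completions_def by auto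
  have "ennreal (residual {} v) \<le> ennreal (\<Sum>i\<in>S. max 0 (v i))"
    unfolding S(2) by (intro ennreal_leI sum_mono) auto
  also have "\<dots> = (\<Sum>i\<in>S. ennreal (max 0 (v i)))"
    by (intro sum_ennreal[symmetric]) auto
  also have "\<dots> = (\<Sum>i\<in>S. ennreal (v i))"
    by (intro sum.cong refl) (auto simp: max_def ennreal_neg)
  also have "\<dots> \<le> (\<Sum>i | i < n \<and> indep {i}. ennreal (v i))"
    using sub by (intro sum_mono2) auto
  finally show ?thesis .
qed

end

text \<open>Permuting the owners of the times does not change the sorted times. One list therefore
  serves every arrival order, without knowledge of the order to come.\<close>

lemma map_sort_key_permuted:
  fixes T :: "nat \<Rightarrow> real"
  assumes p: "p permutes {..<n}"
  shows "map (T \<circ> p) (sort_key (T \<circ> p) [0..<n]) = sort (map T [0..<n])"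
proof (rule properties_for_sort[symmetric])
  have "image_mset p (mset_set {..<n}) = mset_set {..<n}"
    using p by (simp add: image_mset_mset_set permutes_inj_on permutes_image)
  then have "image_mset T (image_mset p (mset_set {..<n})) = image_mset T (mset_set {..<n})" by simp
  then show "mset (map (T \<circ> p) (sort_key (T \<circ> p) [0..<n])) = mset (map T [0..<n])"
    by (simp add: mset_upt lessThan_atLeast0 image_mset.compositionality)
qed (rule sorted_sort_key)

text \<open>Assigning fixed distinct times to the elements in all possible ways produces each
  arrival order exactly once. Injectivity suffices, since both sets have \<open>fact n\<close>
  elements.\<close>

lemma bij_betw_sort_key_permutes:
  fixes T :: "nat \<Rightarrow> real"
  assumes inj: "inj_on T {..<n}"
  shows "bij_betw (\<lambda>p. sort_key (T \<circ> p) [0..<n]) {p. p permutes {..<n}} (permutations_of_set {..<n})"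
    (is "bij_betw ?s ?P ?O")
proof -
  have sub: "?s ` ?P \<subseteq> ?O" by (auto intro!: permutations_of_setI)
  have "inj_on ?s ?P"
  proof (rule inj_onI)
    fix p q assume pq: "p \<in> ?P" "q \<in> ?P" "?s p = ?s q"
    \<comment> \<open>Along the common order both assignments list the same sorted times, so they
      agree at every element.\<close>
    then have "map (T \<circ> p) (?s p) = map (T \<circ> q) (?s p)"
      using map_sort_key_permuted[of p n T] map_sort_key_permuted[of q n T] by simp
    then have eq: "T (p j) = T (q j)" if "j < n" for j using that by simp
    have "p j = q j" for j
    proof (cases "j < n")
      case True
      then have "p j < n" "q j < n" using pq permutes_in_image[of _ "{..<n}" j] by auto
      then show ?thesis using inj eq[OF True] by (auto simp: inj_on_def)
    next
      case False
      then show ?thesis using pq permutes_not_in[of p "{..<n}" j] permutes_not_in[of q "{..<n}" j] by simp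
    qed
    then show "p = q" by auto
  qed
  moreover have "card ?P = card ?O" by (simp add: card_permutations)
  ultimately have "?s ` ?P = ?O"
    using sub by (intro card_subset_eq) (auto simp: card_image)
  with \<open>inj_on ?s ?P\<close> show ?thesis unfolding bij_betw_def by simp
qed

section \<open>Averaging over the arrival orders\<close>

context prophet_matroid
begin

lemma run_value_cong: "(\<And>i. i < n \<Longrightarrow> T i = T' i) \<Longrightarrow> run_value T v = run_value T' v"
  unfolding run_value_def using run_cong[of "\<lambda>_. True" "\<lambda>_. True" T T' v v price] by simp

lemma expected_value_measurable: "(\<lambda>T. \<integral>\<^sup>+v. ennreal (run_value T v) \<partial>P) \<in> borel_measurable PT"
proof (rule D.P.borel_measurable_nn_integral)
  have "(\<lambda>z. run_value (fst z) (snd z)) \<in> borel_measurable (PT \<Otimes>\<^sub>M P)"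
    by (rule run_value_measurable)
      (auto intro: measurable_compose[OF measurable_fst component_PT] measurable_compose[OF measurable_snd component_P])
  then show "(\<lambda>(T, v). ennreal (run_value T v)) \<in> borel_measurable (PT \<Otimes>\<^sub>M P)"
    by (simp add: split_def)
qed

text \<open>Independent, identically distributed times are exchangeable, so relabelling them does
  not change the expected value.\<close>

lemma permuted_times:
  assumes p: "p permutes {..<n}"
  shows "(\<lambda>T. \<integral>\<^sup>+v. ennreal (run_value (T \<circ> p) v) \<partial>P) \<in> borel_measurable PT"
    and "(\<integral>\<^sup>+T. \<integral>\<^sup>+v. ennreal (run_value (T \<circ> p) v) \<partial>P \<partial>PT) = (\<integral>\<^sup>+T. \<integral>\<^sup>+v. ennreal (run_value T v) \<partial>P \<partial>PT)"
proof -
  \<comment> \<open>Restriction keeps the permuted times in the space of \<open>PT\<close>;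
    \<open>run_value\<close> sees only indices below \<open>n\<close>.\<close>
  let ?r = "\<lambda>T. \<lambda>i\<in>{..<n}. T (p i)"
  let ?F = "\<lambda>T. \<integral>\<^sup>+v. ennreal (run_value T v) \<partial>P"
  have in_ground: "p i < n" if "i < n" for i using p that permutes_in_image[of p "{..<n}" i] by simp
  have r: "?r \<in> measurable PT PT"
    by (rule measurable_restrict) (auto intro!: measurable_component_singleton simp: in_ground)
  have eq: "?F (?r T) = ?F (T \<circ> p)" for T
    using run_value_cong[of "?r T" "T \<circ> p"] by simp
  show "(\<lambda>T. ?F (T \<circ> p)) \<in> borel_measurable PT"
    using measurable_compose[OF r expected_value_measurable] unfolding eq .
  have "distr PT PT ?r = PT"
    using distr_PiM_reindex[of "{..<n}" "\<lambda>_. unif" p "{..<n}"] p in_ground prob_space_unif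
    by (auto simp: permutes_inj_on)
  then have "(\<integral>\<^sup>+T. ?F T \<partial>PT) = (\<integral>\<^sup>+T. ?F T \<partial>distr PT PT ?r)" by simp
  also have "\<dots> = (\<integral>\<^sup>+T. ?F (?r T) \<partial>PT)"
    by (rule nn_integral_distr[OF r]) (simp add: expected_value_measurable)
  finally show "(\<integral>\<^sup>+T. ?F (T \<circ> p) \<partial>PT) = (\<integral>\<^sup>+T. ?F T \<partial>PT)" unfolding eq by simp
qed

text \<open>By exchangeability, the sum over all \<open>p\<close> of the values with times
  \<open>T \<circ> p\<close> has mean at least \<open>fact n * c\<close>, so a single injective
  \<open>T\<close> reaches this level. For that \<open>T\<close> the permutations correspond to the
  arrival orders, all with the same sorted list \<open>\<tau>\<close>. The guarantee concerns the
  average over orders, not each order.\<close>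

lemma threshold_rule_competitive:
  "\<exists>\<tau>. (\<forall>\<sigma>\<in>permutations_of_set {..<n}. (\<lambda>v. alg_value (threshold_rule price \<tau>) v \<sigma>) \<in> borel_measurable P) \<and>
    ennreal (1 - exp (-1)) * (\<integral>\<^sup>+v. ennreal (opt_value indep v) \<partial>P)
    \<le> ennreal (1 / real (card (permutations_of_set {..<n}))) *
      (\<Sum>\<sigma>\<in>permutations_of_set {..<n}. \<integral>\<^sup>+v. ennreal (alg_value (threshold_rule price \<tau>) v \<sigma>) \<partial>P)"
proof -
  let ?F = "\<lambda>T. \<integral>\<^sup>+v. ennreal (run_value T v) \<partial>P"
  let ?Pm = "{p. p permutes {..<n}}"
  define c where "c = ennreal (discount 0 * exp_residual {})"
  have cardP: "card ?Pm = fact n" by (simp add: card_permutations)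
  have "of_nat (fact n) * c \<le> (\<Sum>p\<in>?Pm. \<integral>\<^sup>+T. ?F T \<partial>PT)"
    using expected_run_value unfolding c_def by (simp add: cardP mult_left_mono)
  also have "\<dots> = (\<integral>\<^sup>+T. (\<Sum>p\<in>?Pm. ?F (T \<circ> p)) \<partial>PT)"
    by (subst nn_integral_sum) (auto simp: permuted_times)
  finally have avg: "of_nat (fact n) * c \<le> (\<integral>\<^sup>+T. (\<Sum>p\<in>?Pm. ?F (T \<circ> p)) \<partial>PT)" .
  have m: "(\<lambda>T. \<Sum>p\<in>?Pm. ?F (T \<circ> p)) \<in> borel_measurable PT"
    by (intro borel_measurable_sum permuted_times) auto
  have "of_nat (fact n) * c < \<infinity>" unfolding c_def by (simp add: ennreal_mult_less_top of_nat_less_top del: of_nat_fact)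
  from unif_prod.P.exists_ge_nn_integral[OF m AE_unif_prod_good avg this]
  obtain T where T: "inj_on T {..<n}" and ge: "of_nat (fact n) * c \<le> (\<Sum>p\<in>?Pm. ?F (T \<circ> p))"
    by blast
  define \<tau> where "\<tau> = sort (map T [0..<n])"
  let ?s = "\<lambda>p. sort_key (T \<circ> p) [0..<n]"
  have val: "alg_value (threshold_rule price \<tau>) v (?s p) = run_value (T \<circ> p) v" if p: "p \<in> ?Pm" for p v
  proof -
    have "taken (run_alg (threshold_rule price \<tau>) v (?s p) []) = fold (step price (T \<circ> p) v) (?s p) (taken [])"
    proof (rule taken_threshold_rule)
      fix k assume "k < length (?s p)"
      then show "(T \<circ> p) (?s p ! k) = \<tau> ! (length [] + k)"
        using map_sort_key_permuted[of p n T] p nth_map[of k "?s p" "T \<circ> p"] unfolding \<tau>_def by simp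
    qed
    then show ?thesis
      unfolding alg_value_def run_value_def selected_eq_taken run_def by (simp add: taken_simps)
  qed
  note bij = bij_betw_sort_key_permutes[OF T]
  have "(\<lambda>v. alg_value (threshold_rule price \<tau>) v \<sigma>) \<in> borel_measurable P"
    if "\<sigma> \<in> permutations_of_set {..<n}" for \<sigma>
  proof -
    have "\<sigma> \<in> ?s ` ?Pm" using that bij_betw_imp_surj_on[OF bij] by simp
    then obtain p where p: "p \<in> ?Pm" "\<sigma> = ?s p" by (rule imageE)
    have "(\<lambda>v. run_value (T \<circ> p) v) \<in> borel_measurable P"
      by (rule run_value_measurable) (simp_all add: component_P)
    then show ?thesis unfolding p(2) val[OF p(1)] .
  qed
  moreover have "ennreal (1 - exp (-1)) * (\<integral>\<^sup>+v. ennreal (opt_value indep v) \<partial>P)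
    \<le> ennreal (1 / real (card (permutations_of_set {..<n}))) *
      (\<Sum>\<sigma>\<in>permutations_of_set {..<n}. \<integral>\<^sup>+v. ennreal (alg_value (threshold_rule price \<tau>) v \<sigma>) \<partial>P)"
  proof -
    have "(\<Sum>\<sigma>\<in>permutations_of_set {..<n}. \<integral>\<^sup>+v. ennreal (alg_value (threshold_rule price \<tau>) v \<sigma>) \<partial>P)
        = (\<Sum>p\<in>?Pm. ?F (T \<circ> p))"
      by (subst sum.reindex_bij_betw[OF bij, symmetric]) (auto simp: val intro!: sum.cong)
    moreover have "ennreal (1 - exp (-1)) * (\<integral>\<^sup>+v. ennreal (opt_value indep v) \<partial>P) = c"
      using exp_residual_nonneg[OF indep_empty]
      by (simp add: opt_value_eq_residual nn_integral_residual[OF indep_empty] c_def discount_def ennreal_mult)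
    moreover have "ennreal (1 / fact n) * (of_nat (fact n) * c) = c"
      by (simp add: mult.assoc[symmetric] ennreal_of_nat_eq_real_of_nat ennreal_mult[symmetric])
    ultimately show ?thesis using mult_left_mono[OF ge, of "ennreal (1 / fact n)"] by simp
  qed
  ultimately show ?thesis by blast
qed

end

text \<open>The seed is a point mass at 0 and is ignored, which turns a deterministic rule into the
  randomised form asked for.\<close>

lemma deterministic_rule_suffices:
  fixes P :: "(nat \<Rightarrow> real) measure"
  assumes "prob_space P"
    and "\<And>v \<sigma>. \<sigma> \<in> \<Sigma> \<Longrightarrow> indep (selected A v \<sigma>)"
    and meas: "\<And>\<sigma>. \<sigma> \<in> \<Sigma> \<Longrightarrow> (\<lambda>v. alg_value A v \<sigma>) \<in> borel_measurable P"
    and ge: "b \<le> a * (\<Sum>\<sigma>\<in>\<Sigma>. \<integral>\<^sup>+v. ennreal (alg_value A v \<sigma>) \<partial>P)"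
  shows "\<exists>(R :: real measure) (alg :: real \<Rightarrow> online_rule).
    prob_space R \<and>
    (\<forall>r v \<sigma>. \<sigma> \<in> \<Sigma> \<longrightarrow> indep (selected (alg r) v \<sigma>)) \<and>
    (\<forall>\<sigma>\<in>\<Sigma>. (\<lambda>(r, v). alg_value (alg r) v \<sigma>) \<in> borel_measurable (R \<Otimes>\<^sub>M P)) \<and>
    a * (\<Sum>\<sigma>\<in>\<Sigma>. \<integral>\<^sup>+ (r, v). ennreal (alg_value (alg r) v \<sigma>) \<partial>(R \<Otimes>\<^sub>M P)) \<ge> b"
proof -
  interpret P: prob_space P by fact
  define R :: "real measure" where "R = return borel 0"
  interpret R: prob_space R unfolding R_def by (rule prob_space_return) simp
  have m: "(\<lambda>(r, v). alg_value A v \<sigma>) \<in> borel_measurable (R \<Otimes>\<^sub>M P)" if "\<sigma> \<in> \<Sigma>" for \<sigma>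
    unfolding split_def by (rule measurable_compose[OF measurable_snd meas[OF that]])
  have "(\<integral>\<^sup>+ (r, v). ennreal (alg_value A v \<sigma>) \<partial>(R \<Otimes>\<^sub>M P)) = (\<integral>\<^sup>+v. ennreal (alg_value A v \<sigma>) \<partial>P)"
    if "\<sigma> \<in> \<Sigma>" for \<sigma>
  proof -
    have "(\<lambda>(r, v). ennreal (alg_value A v \<sigma>)) \<in> borel_measurable (R \<Otimes>\<^sub>M P)"
      using m[OF that] unfolding split_def by measurable
    from P.nn_integral_fst[OF this] show ?thesis by (simp add: R.emeasure_space_1)
  qed
  then have "b \<le> a * (\<Sum>\<sigma>\<in>\<Sigma>. \<integral>\<^sup>+ (r, v). ennreal (alg_value A v \<sigma>) \<partial>(R \<Otimes>\<^sub>M P))"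
    using ge by simp
  then show ?thesis using R.prob_space_axioms assms(2) m by (intro exI[of _ R] exI[of _ "\<lambda>_. A"]) auto
qed

section \<open>Finite and infinite expected optimum\<close>

theorem theorem1:
  fixes n :: nat and indep :: "nat set \<Rightarrow> bool" and D :: "nat \<Rightarrow> real measure"
  assumes "matroid_on n indep"
    and "\<And>i. i < n \<Longrightarrow> prob_space (D i)"
    and "\<And>i. i < n \<Longrightarrow> sets (D i) = sets borel"
    and "\<And>i. i < n \<Longrightarrow> (AE x in D i. 0 \<le> x)"
  shows "\<exists>(R :: real measure) (alg :: real \<Rightarrow> online_rule).
    prob_space R \<and>
    (\<forall>r v \<sigma>. \<sigma> \<in> permutations_of_set {..<n} \<longrightarrow> indep (selected (alg r) v \<sigma>)) \<and>
    (\<forall>\<sigma>\<in>permutations_of_set {..<n}.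
       (\<lambda>(r, v). alg_value (alg r) v \<sigma>) \<in> borel_measurable (R \<Otimes>\<^sub>M PiM {..<n} D)) \<and>
    ennreal (1 / real (card (permutations_of_set {..<n}))) *
      (\<Sum>\<sigma>\<in>permutations_of_set {..<n}.
         \<integral>\<^sup>+ (r, v). ennreal (alg_value (alg r) v \<sigma>) \<partial>(R \<Otimes>\<^sub>M PiM {..<n} D))
    \<ge> ennreal (1 - exp (-1)) * (\<integral>\<^sup>+ v. ennreal (opt_value indep v) \<partial>(PiM {..<n} D))"
proof -
  interpret finite_matroid n indep by unfold_locales fact
  \<comment> \<open>Point masses beyond the ground set provide a distribution for every index and
    leave the product over \<open>{..<n}\<close> unchanged.\<close>
  define D' where "D' i = (if i < n then D i else return borel 0)" for i
  have D': "prob_space (D' i)" "sets (D' i) = sets borel" for i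
    using assms(2,3) unfolding D'_def by (auto intro: prob_space_return)
  have PD: "PiM {..<n} D = PiM {..<n} D'" by (rule PiM_cong) (auto simp: D'_def)
  have P: "prob_space (PiM {..<n} D)" unfolding PD by (intro prob_space_PiM D')
  show ?thesis
  proof (cases "(\<integral>\<^sup>+v. ennreal (residual {} v) \<partial>PiM {..<n} D) < \<infinity>")
    case True
    interpret prophet_matroid n indep D'
    proof (intro prophet_matroid.intro prophet_matroid_axioms.intro finite_matroid_axioms D')
      show "(\<integral>\<^sup>+v. ennreal (residual {} v) \<partial>PiM {..<n} D') < \<infinity>" using True unfolding PD .
    qed
    obtain \<tau> where \<tau>:
      "\<And>\<sigma>. \<sigma> \<in> permutations_of_set {..<n} \<Longrightarrow>
        (\<lambda>v. alg_value (threshold_rule price \<tau>) v \<sigma>) \<in> borel_measurable (PiM {..<n} D)"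
      "ennreal (1 - exp (-1)) * (\<integral>\<^sup>+v. ennreal (opt_value indep v) \<partial>PiM {..<n} D)
        \<le> ennreal (1 / real (card (permutations_of_set {..<n}))) *
          (\<Sum>\<sigma>\<in>permutations_of_set {..<n}.
            \<integral>\<^sup>+v. ennreal (alg_value (threshold_rule price \<tau>) v \<sigma>) \<partial>PiM {..<n} D)"
      using threshold_rule_competitive unfolding PD by blast
    have "indep (selected (threshold_rule price \<tau>) v \<sigma>)" for v \<sigma>
      unfolding selected_eq_taken by (intro taken_threshold_rule_indep) (simp add: taken_simps indep_empty)
    then show ?thesis by (rule deterministic_rule_suffices[OF P _ \<tau>])
  next
    case False
    have comp: "(\<lambda>v. v i) \<in> borel_measurable (PiM {..<n} D)" if "i < n" for i
      using that assms(3) by (intro borel_measurable_component) auto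
    have "(\<integral>\<^sup>+v. ennreal (residual {} v) \<partial>PiM {..<n} D)
        \<le> (\<integral>\<^sup>+v. (\<Sum>i | i < n \<and> indep {i}. ennreal (v i)) \<partial>PiM {..<n} D)"
      by (intro nn_integral_mono residual_le_sum_nonloops)
    also have "\<dots> = (\<Sum>i | i < n \<and> indep {i}. \<integral>\<^sup>+v. ennreal (v i) \<partial>PiM {..<n} D)"
      using comp by (intro nn_integral_sum) auto
    finally have "\<not> (\<Sum>i | i < n \<and> indep {i}. \<integral>\<^sup>+v. ennreal (v i) \<partial>PiM {..<n} D) < \<infinity>"
      using False by (meson le_less_trans)
    then obtain i where i: "i < n" "indep {i}" "(\<integral>\<^sup>+v. ennreal (v i) \<partial>PiM {..<n} D) = \<infinity>"
      by (auto simp flip: less_top)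
    \<comment> \<open>Always taking the element \<open>i\<close> of infinite mean is feasible, as
      \<open>{i}\<close> is independent, and has infinite expected value in every order.\<close>
    define A :: online_rule where "A h j x \<longleftrightarrow> j = i" for h j x
    have taken_A: "taken (run_alg A v \<sigma> h) = taken h \<union> (set \<sigma> \<inter> {i})" for v \<sigma> h
      by (induction \<sigma> arbitrary: h) (auto simp: taken_simps A_def)
    have sel: "selected A v \<sigma> = {i}" if "\<sigma> \<in> permutations_of_set {..<n}" for v \<sigma>
      using that i unfolding selected_eq_taken taken_A by (auto simp: taken_simps permutations_of_set_def)
    then have val: "alg_value A v \<sigma> = v i" if "\<sigma> \<in> permutations_of_set {..<n}" for v \<sigma>
      using that unfolding alg_value_def by simp
    have "ennreal (1 / real (card (permutations_of_set {..<n}))) *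
        (\<Sum>\<sigma>\<in>permutations_of_set {..<n}. \<integral>\<^sup>+v. ennreal (alg_value A v \<sigma>) \<partial>PiM {..<n} D) = \<infinity>"
      by (simp add: val i ennreal_mult_top ennreal_top_mult)
    then show ?thesis
      by (intro deterministic_rule_suffices[OF P, of _ _ A]) (auto simp: sel val i comp)
  qed
qed

end
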